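(* Let $\mathbb{K}\in\{\mathbb{R},\mathbb{C}\}$, and let $\kappa$ be any cardinal with $1\le\kappa\le\mathfrak{c}$, where $\mathfrak{c}$ is the cardinal of $\mathbb{R}$. Let $\mathfrak{M}$ be the maximal ideal space of the Banach algebra $L^{\infty}(\mathbb{T})$, and let $\mathcal{N}\cup\{\infty\}$ be the one-point compactification of a countably infinite discrete space $\mathcal{N}$. Then the Banach space $C\left(\mathfrak{M}\times\mathbb{T}^{\kappa}+\mathcal{N}\cup\{\infty\}\right)$ of $\mathbb{K}$-valued continuous functions on the topological sum of $\mathfrak{M}\times\mathbb{T}^{\kappa}$ and $\mathcal{N}\cup\{\infty\}$ admits an isometric shift.
   Context: $\mathbb{T}$ is the unit circle in $\mathbb{C}$ with Lebesgue measure, $\mathbb{T}^{\kappa}$ is the product of $\kappa$ copies of $\mathbb{T}$ with the product topology, and $L^{\infty}(\mathbb{T})$ is the algebra of essentially bounded measurable complex-valued functions on $\mathbb{T}$ (complex-valued whichever $\mathbb{K}$ is used); $\mathfrak{M}$ carries the Gelfand topology. "$+$" denotes topological sum (disjoint union). For a compact Hausdorff space $X$, $C(X)$ is the Banach space of all $\mathbb{K}$-valued continuous functions on $X$ with the supremum norm. A linear operator $T:E\to E$ on a Banach space $E$ is an isometric shift if (1) $T$ is an isometry (not necessarily surjective), (2) $T(E)$ has codimension $1$ in $E$, and (3) $\bigcap_{n=1}^{\infty}T^n(E)=\{0\}$. "$C(X)$ admits an isometric shift" means that such a $T:C(X)\to C(X)$ exists. *)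

theory Defs
  imports "HOL-Analysis.Analysis" "HOL-Library.Function_Algebras" "HOL-Library.Equipollence"
begin

section \<open>The algebra of essentially bounded functions on the unit circle\<close>

text \<open>Arc length pushed forward from one period and then completed, so that the measurable
  sets are the Lebesgue measurable ones. No normalisation: only the null sets matter below.\<close>

definition circle_lebesgue :: "complex measure" where
  "circle_lebesgue =
     completion (distr (restrict_space lborel {0..<2 * pi}) (restrict_space borel (sphere 0 1)) cis)"

lemma space_circle_lebesgue: "space circle_lebesgue = sphere 0 1"
  by (simp add: circle_lebesgue_def space_restrict_space)

lemma measurable_cis_circle:
  "cis \<in> restrict_space lborel {0..<2 * pi} \<rightarrow>\<^sub>M restrict_space borel (sphere 0 1)"
  by (intro measurable_restrict_space1 measurable_restrict_space2)
     (auto simp: cis_conv_exp intro!: borel_measurable_continuous_onI continuous_intros)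

lemma emeasure_circle_lebesgue: "emeasure circle_lebesgue (sphere 0 1) = 2 * pi"
proof -
  let ?D = "distr (restrict_space lborel {0..<2 * pi}) (restrict_space borel (sphere 0 1)) cis"
  have S: "sphere (0::complex) 1 \<in> sets ?D"
    by (simp add: sets_restrict_space image_iff) (metis Int_UNIV_right sets.top space_borel)
  have "emeasure circle_lebesgue (sphere 0 1) = emeasure ?D (sphere 0 1)"
    unfolding circle_lebesgue_def by (subst emeasure_completion) (use S in \<open>simp_all only: sets_completionI_sets main_part\<close>)
  also have "\<dots> = emeasure (restrict_space lborel {0..<2 * pi})
      (cis -` sphere 0 1 \<inter> space (restrict_space lborel {0..<2 * pi}))"
    by (rule emeasure_distr[OF measurable_cis_circle]) (use S in simp)
  also have "cis -` sphere 0 1 \<inter> space (restrict_space lborel {0..<2 * pi}) = {0..<2 * pi}"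
    by (auto simp: space_restrict_space)
  also have "emeasure (restrict_space lborel {0..<2 * pi}) {0..<2 * pi} = 2 * pi"
    by (simp add: emeasure_restrict_space)
  finally show ?thesis .
qed

lemma AE_circle_lebesgue_False: "\<not> (AE z in circle_lebesgue. False)"
proof
  assume "AE z in circle_lebesgue. False"
  then obtain Z where "{z \<in> space circle_lebesgue. \<not> False} \<subseteq> Z"
    "emeasure circle_lebesgue Z = 0" "Z \<in> sets circle_lebesgue" by (rule AE_E)
  then have "emeasure circle_lebesgue (space circle_lebesgue) = 0"
    using emeasure_mono[of "space circle_lebesgue" Z circle_lebesgue] by simp
  then show False
    by (simp add: space_circle_lebesgue emeasure_circle_lebesgue)
qed

definition ess_bounded :: "(complex \<Rightarrow> complex) \<Rightarrow> bool" where
  "ess_bounded f \<longleftrightarrow> f \<in> borel_measurable circle_lebesgue \<and>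
     (\<exists>B. AE z in circle_lebesgue. norm (f z) \<le> B)"

lemma ess_bounded_const: "ess_bounded (\<lambda>_. c)"
  by (auto simp: ess_bounded_def)

lemma ess_bounded_add:
  assumes "ess_bounded f" "ess_bounded g" shows "ess_bounded (\<lambda>z. f z + g z)"
proof -
  from assms obtain B C where "AE z in circle_lebesgue. norm (f z) \<le> B"
    "AE z in circle_lebesgue. norm (g z) \<le> C" by (auto simp: ess_bounded_def)
  then have "AE z in circle_lebesgue. norm (f z + g z) \<le> B + C"
    by eventually_elim (rule norm_triangle_mono)
  with assms show ?thesis by (auto simp: ess_bounded_def)
qed

lemma ess_bounded_mult:
  assumes "ess_bounded f" "ess_bounded g" shows "ess_bounded (\<lambda>z. f z * g z)"
proof -
  from assms obtain B C where "AE z in circle_lebesgue. norm (f z) \<le> B"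
    "AE z in circle_lebesgue. norm (g z) \<le> C" by (auto simp: ess_bounded_def)
  then have "AE z in circle_lebesgue. norm (f z * g z) \<le> B * C"
    by eventually_elim (auto simp: norm_mult intro!: mult_mono intro: order_trans[OF norm_ge_zero])
  with assms show ?thesis by (auto simp: ess_bounded_def)
qed

lemma ess_bounded_minus: "ess_bounded f \<Longrightarrow> ess_bounded (\<lambda>z. - f z)"
  using ess_bounded_mult[OF ess_bounded_const[of "-1"], of f] by simp

definition linf_rel :: "(complex \<Rightarrow> complex) \<Rightarrow> (complex \<Rightarrow> complex) \<Rightarrow> bool" where
  "linf_rel f g \<longleftrightarrow> ess_bounded f \<and> ess_bounded g \<and> (AE z in circle_lebesgue. f z = g z)"

quotient_type linf_circle = "complex \<Rightarrow> complex" / partial: linf_rel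
proof (rule part_equivpI)
  show "\<exists>f. linf_rel f f"
    by (rule exI[of _ "\<lambda>_. 0"]) (simp add: linf_rel_def ess_bounded_const)
  show "symp linf_rel"
    by (rule sympI) (auto simp: linf_rel_def)
  show "transp linf_rel"
    by (rule transpI) (auto simp: linf_rel_def)
qed

instantiation linf_circle :: comm_ring_1
begin

lift_definition zero_linf_circle :: linf_circle is "\<lambda>_. 0"
  by (simp add: linf_rel_def ess_bounded_const)

lift_definition one_linf_circle :: linf_circle is "\<lambda>_. 1"
  by (simp add: linf_rel_def ess_bounded_const)

lift_definition plus_linf_circle :: "linf_circle \<Rightarrow> linf_circle \<Rightarrow> linf_circle"
  is "\<lambda>f g z. f z + g z"
  by (auto simp: linf_rel_def ess_bounded_add)

lift_definition times_linf_circle :: "linf_circle \<Rightarrow> linf_circle \<Rightarrow> linf_circle"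
  is "\<lambda>f g z. f z * g z"
  by (auto simp: linf_rel_def ess_bounded_mult)

lift_definition uminus_linf_circle :: "linf_circle \<Rightarrow> linf_circle"
  is "\<lambda>f z. - f z"
  by (auto simp: linf_rel_def ess_bounded_minus)

definition minus_linf_circle :: "linf_circle \<Rightarrow> linf_circle \<Rightarrow> linf_circle" where
  "minus_linf_circle f g = f + - g"

instance
proof
  fix a b c :: linf_circle
  show "a - b = a + - b" by (rule minus_linf_circle_def)
  show "(0::linf_circle) \<noteq> 1"
    by transfer (auto simp: linf_rel_def AE_circle_lebesgue_False)
qed (transfer; auto simp: linf_rel_def algebra_simps
       intro!: ess_bounded_add ess_bounded_mult ess_bounded_minus ess_bounded_const)+

end

lift_definition linf_scale :: "complex \<Rightarrow> linf_circle \<Rightarrow> linf_circle" is "\<lambda>c f z. c * f z"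
  by (auto simp: linf_rel_def intro: ess_bounded_mult ess_bounded_const)


section \<open>The maximal ideal space\<close>

text \<open>As usual, the maximal ideal space of a commutative Banach algebra is the set of its nonzero
  complex homomorphisms (a maximal ideal being identified with the homomorphism of which it is
  the kernel). The Gelfand topology is the weakest one making all the Gelfand transforms
  \<open>\<lambda>\<phi>. \<phi> f\<close> continuous.\<close>

definition linf_characters :: "(linf_circle \<Rightarrow> complex) set" where
  "linf_characters = {\<phi>.
     (\<forall>f g. \<phi> (f + g) = \<phi> f + \<phi> g) \<and> (\<forall>c f. \<phi> (linf_scale c f) = c * \<phi> f) \<and>
     (\<forall>f g. \<phi> (f * g) = \<phi> f * \<phi> g) \<and> (\<exists>f. \<phi> f \<noteq> 0)}"

definition linf_max_ideal_space :: "(linf_circle \<Rightarrow> complex) topology" where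
  "linf_max_ideal_space =
     topology_generated_by {{\<phi> \<in> linf_characters. \<phi> f \<in> U} | f U. open U}"

lemma topspace_linf_max_ideal_space: "topspace linf_max_ideal_space = linf_characters"
  unfolding linf_max_ideal_space_def topology_generated_by_topspace
  by (auto intro: exI[of _ UNIV])


section \<open>Topological sums\<close>

definition disjoint_sum_topology :: "'a topology \<Rightarrow> 'b topology \<Rightarrow> ('a + 'b) topology" where
  "disjoint_sum_topology X Y = topology (\<lambda>W. openin X (Inl -` W) \<and> openin Y (Inr -` W))"

lemma openin_disjoint_sum_topology:
  "openin (disjoint_sum_topology X Y) W \<longleftrightarrow> openin X (Inl -` W) \<and> openin Y (Inr -` W)"
proof -
  have "istopology (\<lambda>W. openin X (Inl -` W) \<and> openin Y (Inr -` W))"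
    unfolding istopology_def by (auto simp: vimage_Union intro: openin_Int openin_Union)
  then show ?thesis
    by (simp add: disjoint_sum_topology_def topology_inverse')
qed

lemma topspace_disjoint_sum_topology:
  "topspace (disjoint_sum_topology X Y) = topspace X <+> topspace Y" (is "?L = ?R")
proof
  have "Inl -` ?L \<subseteq> topspace X" "Inr -` ?L \<subseteq> topspace Y"
    using openin_topspace[of "disjoint_sum_topology X Y"]
    by (simp_all only: openin_disjoint_sum_topology openin_subset)
  then show "?L \<subseteq> ?R"
    by (auto simp: Plus_def image_iff elim: sumE) (metis (no_types) old.sum.exhaust subsetD vimageI)
  have "Inl -` ?R = topspace X" "Inr -` ?R = topspace Y" by auto
  then show "?R \<subseteq> ?L"
    by (intro openin_subset) (simp add: openin_disjoint_sum_topology)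
qed


section \<open>Isometric shifts on spaces of continuous functions\<close>

text \<open>The space of continuous functions on \<open>X\<close>. A function on \<open>topspace X\<close> is represented by
  its extension by \<open>0\<close> to the whole type, so that the pointwise operations of the function type
  are the vector space operations.\<close>

definition cfun_space :: "'a topology \<Rightarrow> ('a \<Rightarrow> 'k::real_normed_field) set" where
  "cfun_space X = {f. continuous_map X euclidean f \<and> (\<forall>x. x \<notin> topspace X \<longrightarrow> f x = 0)}"

definition cfun_scale :: "'k::real_normed_field \<Rightarrow> ('a \<Rightarrow> 'k) \<Rightarrow> 'a \<Rightarrow> 'k" where
  "cfun_scale c f = (\<lambda>x. c * f x)"

definition sup_norm :: "'a topology \<Rightarrow> ('a \<Rightarrow> 'k::real_normed_field) \<Rightarrow> real" where
  "sup_norm X f = (SUP x\<in>topspace X. norm (f x))"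

text \<open>\<open>E\<close> is the carrier of a normed space with scalar multiplication \<open>smul\<close> and norm \<open>nrm\<close>;
  only the values of \<open>T\<close> on \<open>E\<close> matter. Codimension 1 means that the quotient of \<open>E\<close> by
  the range of \<open>T\<close> has a basis consisting of one element, the class of \<open>e\<close>.\<close>

definition isometric_shift ::
  "('k::real_normed_field \<Rightarrow> 'v::ab_group_add \<Rightarrow> 'v) \<Rightarrow> ('v \<Rightarrow> real) \<Rightarrow> 'v set \<Rightarrow> ('v \<Rightarrow> 'v) \<Rightarrow> bool"
where
  "isometric_shift smul nrm E T \<longleftrightarrow>
     T ` E \<subseteq> E \<and>
     (\<forall>f\<in>E. \<forall>g\<in>E. T (f + g) = T f + T g) \<and>
     (\<forall>c. \<forall>f\<in>E. T (smul c f) = smul c (T f)) \<and>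
     (\<forall>f\<in>E. nrm (T f) = nrm f) \<and>
     (\<exists>e\<in>E. e \<notin> T ` E \<and> (\<forall>f\<in>E. \<exists>c. f - smul c e \<in> T ` E)) \<and>
     (\<Inter>n\<in>{1..}. (T ^^ n) ` E) = {0}"

text \<open>The type argument selects the scalar field.\<close>

definition admits_isometric_shift :: "'k::real_normed_field itself \<Rightarrow> 'a topology \<Rightarrow> bool" where
  "admits_isometric_shift K X \<longleftrightarrow>
     (\<exists>T :: ('a \<Rightarrow> 'k) \<Rightarrow> 'a \<Rightarrow> 'k.
        isometric_shift cfun_scale (sup_norm X) (cfun_space X) T)"

end

theory Submission
  imports Defs "HOL-Analysis.Kronecker_Approximation_Theorem"
begin

text \<open>
  Let \<open>\<phi>\<close> be a homeomorphism of a compact space \<open>X\<close> and \<open>\<Delta>\<close> a functional of norm at most 1 on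
  \<open>C(X)\<close>. Put \<open>(T f)(x) = - f(\<phi>\<^sup>-\<^sup>1 x)\<close> on \<open>X\<close>, shift the values of \<open>f\<close> along the isolated points
  \<open>n\<^sub>0, n\<^sub>1, \<dots>\<close>, and fill the gap at \<open>n\<^sub>0\<close> by \<open>\<Delta>(f|X)\<close>. If \<open>f\<close> lies in the range of every power
  of \<open>T\<close>, then \<open>f(n\<^sub>k) = (-1)\<^sup>k\<^sup>+\<^sup>1 \<Delta>(f \<circ> \<phi>\<^sup>k\<^sup>+\<^sup>1)\<close>, and these values have to converge. So \<open>T\<close> is a
  shift once the convergence of \<open>(-1)\<^sup>n \<Delta>(f \<circ> \<phi>\<^sup>n)\<close> forces \<open>f = 0\<close> on \<open>X\<close>.

  Here \<open>\<phi>\<close> rotates the circle underlying the maximal ideal space and all coordinates of the torus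
  by angles that are independent over the rationals together with \<open>2\<pi>\<close>; there are continuum many
  such angles. The functional takes the function \<open>u\<close> in \<open>L\<^sup>\<infinity>\<close> whose Gelfand transform is
  \<open>f(\<cdot>, (1, 1, \<dots>))\<close> to the integral of \<open>e\<^sup>-\<^sup>t u(e\<^sup>i\<^sup>t)\<close> over \<open>t \<ge> 0\<close>. Then \<open>\<Delta>(f \<circ> \<phi>\<^sup>n)\<close> samples along
  a dense orbit a function that is continuous on the circle times the torus, already on the even and
  on the odd \<open>n\<close> separately, so the alternating sign forces that function to vanish. As the
  integrals of \<open>e\<^sup>-\<^sup>t u(e\<^sup>i\<^sup>t)\<close> over all half lines determine \<open>u\<close>, also \<open>f\<close> vanishes.
\<close>

section \<open>Shifts from functionals with divergent orbits\<close>

lemma continuous_map_disjoint_sum_topology: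
  "continuous_map (disjoint_sum_topology X Y) Z f \<longleftrightarrow>
     continuous_map X Z (\<lambda>x. f (Inl x)) \<and> continuous_map Y Z (\<lambda>y. f (Inr y))"
proof -
  have eq: "Inl -` {x \<in> topspace X <+> topspace Y. f x \<in> U} = {x \<in> topspace X. f (Inl x) \<in> U}"
    "Inr -` {x \<in> topspace X <+> topspace Y. f x \<in> U} = {y \<in> topspace Y. f (Inr y) \<in> U}" for U
    by auto
  have Pi: "f \<in> topspace X <+> topspace Y \<rightarrow> topspace Z \<longleftrightarrow>
      (\<lambda>x. f (Inl x)) \<in> topspace X \<rightarrow> topspace Z \<and> (\<lambda>y. f (Inr y)) \<in> topspace Y \<rightarrow> topspace Z"
    by (auto simp: Pi_iff)
  show ?thesis
    unfolding continuous_map_def topspace_disjoint_sum_topology openin_disjoint_sum_topology eq Pi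
    by blast
qed

lemma continuous_map_euclidean_iff_tendsto:
  "continuous_map X euclidean f \<longleftrightarrow> (\<forall>x\<in>topspace X. (f \<longlongrightarrow> f x) (atin X x))"
  by (simp add: continuous_map_atin limitin_canonical_iff)

lemma compact_space_disjoint_sum_topology:
  assumes "compact_space X" "compact_space Y"
  shows "compact_space (disjoint_sum_topology X Y)"
proof -
  let ?S = "disjoint_sum_topology X Y"
  have "continuous_map ?S ?S (\<lambda>x. x)" by simp
  then have "continuous_map X ?S Inl" "continuous_map Y ?S Inr"
    by (simp_all only: continuous_map_disjoint_sum_topology)
  then have "compactin ?S (Inl ` topspace X)" "compactin ?S (Inr ` topspace Y)"
    using assms by (auto simp: compact_space_def intro: image_compactin)
  then have "compactin ?S (Inl ` topspace X \<union> Inr ` topspace Y)"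
    by (rule compactin_Un)
  then show ?thesis
    by (simp add: compact_space_def topspace_disjoint_sum_topology Plus_def)
qed

text \<open>Compact subsets of a discrete space are finite, so the open neighbourhoods of
  \<open>None\<close> are the sets around it that miss only finitely many points. An enumeration of
  \<open>N\<close> turns this into convergence of a sequence.\<close>

lemma continuous_map_Alexandroff_discrete:
  fixes f :: "'n option \<Rightarrow> 'b::topological_space"
  assumes \<nu>: "bij_betw \<nu> (UNIV :: nat set) N"
  shows "continuous_map (Alexandroff_compactification (discrete_topology N)) euclidean f \<longleftrightarrow>
           (\<lambda>k. f (Some (\<nu> k))) \<longlonglongrightarrow> f None"
    (is "continuous_map ?A _ _ \<longleftrightarrow> ?lim")
proof
  have inj: "inj \<nu>" and ran: "range \<nu> = N" using \<nu> by (auto simp: bij_betw_def)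
  have top: "topspace ?A = insert None (Some ` N)" by simp
  show ?lim if c: "continuous_map ?A euclidean f"
  proof (rule topological_tendstoI)
    fix U assume "open U" "f None \<in> U"
    then have "openin ?A {y \<in> topspace ?A. f y \<in> U}"
      using c by (auto simp: continuous_map_def)
    then obtain C where "finite C" and C: "{y \<in> topspace ?A. f y \<in> U} = insert None (Some ` (N - C))"
      using \<open>f None \<in> U\<close> by (auto simp: openin_Alexandroff_compactification compactin_discrete_topology)
    have "finite (\<nu> -` C)" using \<open>finite C\<close> inj by (rule finite_vimageI)
    then have "\<forall>\<^sub>F k in sequentially. k \<notin> \<nu> -` C"
      by (simp add: eventually_cofinite vimage_def flip: cofinite_eq_sequentially)
    then show "\<forall>\<^sub>F k in sequentially. f (Some (\<nu> k)) \<in> U"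
    proof eventually_elim
      case (elim k)
      then have "Some (\<nu> k) \<in> insert None (Some ` (N - C))" using ran by auto
      then show ?case unfolding C[symmetric] by simp
    qed
  qed
  show "continuous_map ?A euclidean f" if lim: ?lim
    unfolding continuous_map_def
  proof safe
    fix U :: "'b set" assume "openin euclidean U"
    then have "open U" by simp
    show "openin ?A {y \<in> topspace ?A. f y \<in> U}"
    proof (cases "f None \<in> U")
      case True
      let ?C = "{m \<in> N. f (Some m) \<notin> U}"
      have "finite {k. f (Some (\<nu> k)) \<notin> U}"
        using topological_tendstoD[OF lim \<open>open U\<close> True]
        by (simp add: eventually_cofinite flip: cofinite_eq_sequentially)
      moreover have "?C = \<nu> ` {k. f (Some (\<nu> k)) \<notin> U}" using ran by auto
      ultimately have "finite ?C" by simp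
      moreover have "{y \<in> topspace ?A. f y \<in> U} = insert None (Some ` (N - ?C))"
        using True by auto
      ultimately show ?thesis
        unfolding openin_Alexandroff_compactification
        by (intro disjI2 exI[of _ ?C]) (simp add: compactin_discrete_topology closedin_def)
    next
      case False
      then have "{y \<in> topspace ?A. f y \<in> U} = Some ` {m \<in> N. f (Some m) \<in> U}" by auto
      moreover have "openin (discrete_topology N) {m \<in> N. f (Some m) \<in> U}" by auto
      ultimately show ?thesis by (simp only: openin_Alexandroff_compactification_image_Some)
    qed
  qed simp
qed

text \<open>\<open>\<Delta>\<close> is applied to functions on the whole type, so
  \<open>\<Delta>_cong\<close> makes it depend on the values on \<open>X\<close> alone. The bound
  \<open>B\<close> in \<open>\<Delta>_bound\<close> expresses norm at most 1 without a supremum,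
  which covers empty \<open>X\<close>.\<close>

locale orbit_functional =
  fixes X :: "'a topology" and \<phi> \<psi> :: "'a \<Rightarrow> 'a" and N :: "'n set" and \<nu> :: "nat \<Rightarrow> 'n"
    and \<Delta> :: "('a \<Rightarrow> 'k::real_normed_field) \<Rightarrow> 'k"
  assumes compact: "compact_space X"
    and homeo: "homeomorphic_maps X X \<phi> \<psi>"
    and enum: "bij_betw \<nu> UNIV N"
    and \<Delta>_cong: "\<And>f g. (\<And>x. x \<in> topspace X \<Longrightarrow> f x = g x) \<Longrightarrow> \<Delta> f = \<Delta> g"
    and \<Delta>_add: "\<And>f g. continuous_map X euclidean f \<Longrightarrow> continuous_map X euclidean g \<Longrightarrow>
      \<Delta> (\<lambda>x. f x + g x) = \<Delta> f + \<Delta> g"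
    and \<Delta>_scale: "\<And>c f. continuous_map X euclidean f \<Longrightarrow> \<Delta> (\<lambda>x. c * f x) = c * \<Delta> f"
    and \<Delta>_bound: "\<And>f B. continuous_map X euclidean f \<Longrightarrow> 0 \<le> B \<Longrightarrow>
      (\<And>x. x \<in> topspace X \<Longrightarrow> norm (f x) \<le> B) \<Longrightarrow> norm (\<Delta> f) \<le> B"
    and \<Delta>_orbit: "\<And>f x. continuous_map X euclidean f \<Longrightarrow>
      convergent (\<lambda>n. (-1) ^ n * \<Delta> (\<lambda>x. f ((\<phi> ^^ n) x))) \<Longrightarrow> x \<in> topspace X \<Longrightarrow> f x = 0"
begin

abbreviation "S \<equiv> disjoint_sum_topology X (Alexandroff_compactification (discrete_topology N))"

text \<open>For \<open>m\<close> in \<open>N\<close> other than \<open>\<nu> 0\<close> the index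
  \<open>inv \<nu> m\<close> is at least 1, so the truncated subtraction moves back by exactly one
  place. The value 0 off the underlying space keeps the result in
  \<open>cfun_space S\<close>.\<close>

definition shift :: "('a + 'n option \<Rightarrow> 'k) \<Rightarrow> 'a + 'n option \<Rightarrow> 'k" where
  "shift f y = (case y of
      Inl x \<Rightarrow> if x \<in> topspace X then - f (Inl (\<psi> x)) else 0
    | Inr None \<Rightarrow> f (Inr None)
    | Inr (Some m) \<Rightarrow>
        if m \<notin> N then 0 else if m = \<nu> 0 then \<Delta> (\<lambda>x. f (Inl x))
        else f (Inr (Some (\<nu> (inv \<nu> m - 1)))))"

section \<open>The operator attached to an orbit functional is an isometric shift\<close>

lemma inj_\<nu>: "inj \<nu>" and range_\<nu>: "range \<nu> = N"
  using enum by (auto simp: bij_betw_def)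

lemma \<nu>_in: "\<nu> k \<in> N"
  using range_\<nu> by auto

lemma \<nu>_cases: assumes "m \<in> N" obtains k where "m = \<nu> k"
  using assms range_\<nu> by auto

lemma shift_simps [simp]:
  "x \<in> topspace X \<Longrightarrow> shift f (Inl x) = - f (Inl (\<psi> x))"
  "x \<notin> topspace X \<Longrightarrow> shift f (Inl x) = 0"
  "shift f (Inr None) = f (Inr None)"
  "m \<notin> N \<Longrightarrow> shift f (Inr (Some m)) = 0"
  "shift f (Inr (Some (\<nu> 0))) = \<Delta> (\<lambda>x. f (Inl x))"
  "shift f (Inr (Some (\<nu> (Suc k)))) = f (Inr (Some (\<nu> k)))"
  using inj_\<nu> \<nu>_in by (auto simp: shift_def inj_eq)

lemma topspace_S: "topspace S = Inl ` topspace X \<union> insert (Inr None) (range (\<lambda>k. Inr (Some (\<nu> k))))"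
  using range_\<nu> by (auto simp: topspace_disjoint_sum_topology)

lemma cfun_space_S_iff:
  "f \<in> cfun_space S \<longleftrightarrow> continuous_map X euclidean (\<lambda>x. f (Inl x)) \<and>
     (\<lambda>k. f (Inr (Some (\<nu> k)))) \<longlonglongrightarrow> f (Inr None) \<and>
     (\<forall>x. x \<notin> topspace X \<longrightarrow> f (Inl x) = 0) \<and> (\<forall>m. m \<notin> N \<longrightarrow> f (Inr (Some m)) = 0)"
proof -
  have "(\<forall>y. y \<notin> topspace S \<longrightarrow> f y = 0) \<longleftrightarrow>
      (\<forall>x. x \<notin> topspace X \<longrightarrow> f (Inl x) = 0) \<and> (\<forall>m. m \<notin> N \<longrightarrow> f (Inr (Some m)) = 0)"
    unfolding topspace_disjoint_sum_topology
    by (simp add: split_sum_all split_option_all Plus_def image_iff) metis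
  then show ?thesis
    unfolding cfun_space_def continuous_map_disjoint_sum_topology
      continuous_map_Alexandroff_discrete[OF enum] by simp
qed

text \<open>The value at infinity is the limit of the values at the isolated points, so agreement
  there is automatic.\<close>

lemma S_ext:
  assumes "f \<in> cfun_space S" "g \<in> cfun_space S"
    and "\<And>x. x \<in> topspace X \<Longrightarrow> f (Inl x) = g (Inl x)"
    and "\<And>k. f (Inr (Some (\<nu> k))) = g (Inr (Some (\<nu> k)))"
  shows "f = g"
proof
  have "(\<lambda>k. f (Inr (Some (\<nu> k)))) \<longlonglongrightarrow> f (Inr None)"
    "(\<lambda>k. f (Inr (Some (\<nu> k)))) \<longlonglongrightarrow> g (Inr None)"
    using assms(1,2) unfolding cfun_space_S_iff by (simp_all add: assms(4))
  then have "f (Inr None) = g (Inr None)"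
    by (rule LIMSEQ_unique)
  moreover have "f (Inl x) = g (Inl x)" for x
    using assms(1-3) unfolding cfun_space_S_iff by (cases "x \<in> topspace X") auto
  moreover have "f (Inr (Some m)) = g (Inr (Some m))" for m
  proof (cases "m \<in> N")
    case True
    then show ?thesis using assms(4) by (auto elim: \<nu>_cases)
  next
    case False
    then show ?thesis using assms(1,2) unfolding cfun_space_S_iff by simp
  qed
  ultimately show "f y = g y" for y
    by (metis sum.exhaust option.exhaust)
qed

lemma cont_\<psi>: "continuous_map X X \<psi>" and cont_\<phi>: "continuous_map X X \<phi>"
  and \<psi>_in: "x \<in> topspace X \<Longrightarrow> \<psi> x \<in> topspace X" and \<phi>_in: "x \<in> topspace X \<Longrightarrow> \<phi> x \<in> topspace X"
  and \<psi>\<phi>: "x \<in> topspace X \<Longrightarrow> \<psi> (\<phi> x) = x" and \<phi>\<psi>: "x \<in> topspace X \<Longrightarrow> \<phi> (\<psi> x) = x"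
  using homeo by (auto simp: homeomorphic_maps_def continuous_map_def)

lemma cont_Inl: "f \<in> cfun_space S \<Longrightarrow> continuous_map X euclidean (\<lambda>x. f (Inl x))"
  by (simp add: cfun_space_S_iff)

lemma shift_in: assumes f: "f \<in> cfun_space S" shows "shift f \<in> cfun_space S"
proof -
  have "continuous_map X euclidean (\<lambda>x. - f (Inl (\<psi> x)))"
    using continuous_map_compose[OF cont_\<psi> cont_Inl[OF f]]
    by (auto intro: continuous_map_minus simp: o_def)
  then have "continuous_map X euclidean (\<lambda>x. shift f (Inl x))"
    by (rule continuous_map_eq) simp
  moreover have "(\<lambda>k. shift f (Inr (Some (\<nu> (Suc k))))) \<longlonglongrightarrow> shift f (Inr None)"
    using f by (simp add: cfun_space_S_iff)
  ultimately show ?thesis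
    unfolding cfun_space_S_iff using LIMSEQ_imp_Suc[of "\<lambda>k. shift f (Inr (Some (\<nu> k)))"] by simp
qed

lemma add_in: "f \<in> cfun_space S \<Longrightarrow> g \<in> cfun_space S \<Longrightarrow> f + g \<in> cfun_space S"
  unfolding cfun_space_S_iff continuous_map_euclidean_iff_tendsto by (auto intro: tendsto_add)

lemma scale_in: "f \<in> cfun_space S \<Longrightarrow> cfun_scale c f \<in> cfun_space S"
  unfolding cfun_space_S_iff cfun_scale_def continuous_map_euclidean_iff_tendsto
  by (auto intro: tendsto_mult_left)

lemma shift_add:
  assumes f: "f \<in> cfun_space S" and g: "g \<in> cfun_space S"
  shows "shift (f + g) = shift f + shift g"
proof (rule S_ext[OF shift_in[OF add_in[OF f g]] add_in[OF shift_in[OF f] shift_in[OF g]]])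
  show "shift (f + g) (Inr (Some (\<nu> k))) = (shift f + shift g) (Inr (Some (\<nu> k)))" for k
    by (cases k) (simp_all add: \<Delta>_add cont_Inl f g)
qed simp

lemma shift_scale:
  assumes f: "f \<in> cfun_space S"
  shows "shift (cfun_scale c f) = cfun_scale c (shift f)"
proof (rule S_ext[OF shift_in[OF scale_in[OF f]] scale_in[OF shift_in[OF f]]])
  show "shift (cfun_scale c f) (Inr (Some (\<nu> k))) = cfun_scale c (shift f) (Inr (Some (\<nu> k)))" for k
    by (cases k) (simp_all add: cfun_scale_def \<Delta>_scale cont_Inl f)
qed (simp add: cfun_scale_def)

lemma norm_le_sup_norm:
  assumes "f \<in> cfun_space S" "y \<in> topspace S"
  shows "norm (f y) \<le> sup_norm S f"
proof -
  have c: "compact_space S"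
    by (intro compact_space_disjoint_sum_topology compact) simp
  have "continuous_map S euclidean f" using assms by (simp add: cfun_space_def)
  then have "compact (f ` topspace S)"
    using c image_compactin[of S "topspace S" euclidean f] by (simp add: compact_space_def)
  then have "bounded (f ` topspace S)" by (rule compact_imp_bounded)
  then have "bdd_above ((\<lambda>x. norm (f x)) ` topspace S)"
    by (auto simp: bounded_iff bdd_above_def)
  then show ?thesis
    using assms(2) unfolding sup_norm_def by (intro cSUP_upper) auto
qed

lemma sup_norm_le:
  assumes "\<And>y. y \<in> topspace S \<Longrightarrow> norm (f y) \<le> B"
  shows "sup_norm S f \<le> B"
  using assms unfolding sup_norm_def by (intro cSUP_least) (auto simp: topspace_disjoint_sum_topology)

text \<open>The only value of \<open>shift f\<close> that is not a value of \<open>f\<close> up to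
  sign is the one at \<open>\<nu> 0\<close>, and \<open>\<Delta>_bound\<close> controls it.
  Conversely every value of \<open>f\<close> reappears in \<open>shift f\<close> up to sign: at
  \<open>\<phi> x\<close>, at infinity, or one place further along.\<close>

lemma sup_norm_shift:
  assumes f: "f \<in> cfun_space S"
  shows "sup_norm S (shift f) = sup_norm S f"
proof (rule antisym)
  show "sup_norm S (shift f) \<le> sup_norm S f"
  proof (rule sup_norm_le)
    have nn: "0 \<le> sup_norm S f"
      by (rule order_trans[OF norm_ge_zero norm_le_sup_norm[OF f, of "Inr None"]])
        (simp add: topspace_S)
    have \<Delta>: "norm (\<Delta> (\<lambda>x. f (Inl x))) \<le> sup_norm S f"
      by (rule \<Delta>_bound[OF cont_Inl[OF f] nn]) (auto intro!: norm_le_sup_norm f simp: topspace_S)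
    have seq: "norm (shift f (Inr (Some (\<nu> k)))) \<le> sup_norm S f" for k
      using \<Delta> by (cases k) (auto intro!: norm_le_sup_norm f simp: topspace_S)
    fix y assume "y \<in> topspace S"
    then show "norm (shift f y) \<le> sup_norm S f"
      unfolding topspace_S using seq by (auto intro!: norm_le_sup_norm f simp: topspace_S \<psi>_in)
  qed
  show "sup_norm S f \<le> sup_norm S (shift f)"
  proof (rule sup_norm_le)
    note bd = norm_le_sup_norm[OF shift_in[OF f]]
    fix y assume "y \<in> topspace S"
    then consider x where "x \<in> topspace X" "y = Inl x" | "y = Inr None" | k where "y = Inr (Some (\<nu> k))"
      unfolding topspace_S by auto
    then show "norm (f y) \<le> sup_norm S (shift f)"
    proof cases
      case 1
      then show ?thesis using bd[of "Inl (\<phi> x)"] by (simp add: topspace_S \<phi>_in \<psi>\<phi>)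
    next
      case 2
      then show ?thesis using bd[of y] by (simp add: topspace_S)
    next
      case 3
      then show ?thesis using bd[of "Inr (Some (\<nu> (Suc k)))"] by (simp add: topspace_S)
    qed
  qed
qed

lemma zero_in: "0 \<in> cfun_space S"
  by (simp add: cfun_space_S_iff)

lemma \<Delta>_0: "\<Delta> (\<lambda>x. 0) = 0"
  using \<Delta>_bound[of "\<lambda>x. 0" 0] by simp

text \<open>The value of \<open>shift f\<close> at \<open>\<nu> 0\<close> is dictated by its values
  on \<open>X\<close>, and changing this one value gives a complement of the range. The indicator
  \<open>e\<close> of \<open>\<nu> 0\<close> is outside the range because a preimage would vanish on
  \<open>X\<close>, and then \<open>\<Delta>\<close> would produce 0 at
  \<open>\<nu> 0\<close>.\<close>

lemma shift_codim:
  "\<exists>e\<in>cfun_space S. e \<notin> shift ` cfun_space S \<and>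
     (\<forall>f\<in>cfun_space S. \<exists>c. f - cfun_scale c e \<in> shift ` cfun_space S)"
proof (intro bexI conjI ballI)
  let ?e = "\<lambda>y. of_bool (y = Inr (Some (\<nu> 0))) :: 'k"
  have "(\<lambda>k. ?e (Inr (Some (\<nu> (Suc k))))) \<longlonglongrightarrow> 0"
    using inj_\<nu> by (simp add: inj_eq)
  then have "(\<lambda>k. ?e (Inr (Some (\<nu> k)))) \<longlonglongrightarrow> 0"
    by (rule LIMSEQ_imp_Suc)
  then show e_in: "?e \<in> cfun_space S"
    using \<nu>_in by (auto simp: cfun_space_S_iff)
  show "?e \<notin> shift ` cfun_space S"
  proof
    assume "?e \<in> shift ` cfun_space S"
    then obtain f where f: "f \<in> cfun_space S" and e: "?e = shift f" by auto
    have "f (Inl x) = 0" if "x \<in> topspace X" for x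
      using fun_cong[OF e, of "Inl (\<phi> x)"] that by (simp add: \<phi>_in \<psi>\<phi>)
    then have "\<Delta> (\<lambda>x. f (Inl x)) = 0"
      using \<Delta>_cong[of "\<lambda>x. f (Inl x)" "\<lambda>x. 0"] \<Delta>_0 by simp
    then show False using fun_cong[OF e, of "Inr (Some (\<nu> 0))"] by simp
  qed
  fix f :: "'a + 'n option \<Rightarrow> 'k" assume f: "f \<in> cfun_space S"
  \<comment> \<open>The candidate preimage undoes the shift; the value of \<open>f\<close> at
    \<open>\<nu> 0\<close> is dropped.\<close>
  define g :: "'a + 'n option \<Rightarrow> 'k" where "g y = (case y of
      Inl x \<Rightarrow> if x \<in> topspace X then - f (Inl (\<phi> x)) else 0
    | Inr None \<Rightarrow> f (Inr None)
    | Inr (Some m) \<Rightarrow> if m \<in> N then f (Inr (Some (\<nu> (Suc (inv \<nu> m))))) else 0)" for y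
  have gs: "g (Inr (Some (\<nu> k))) = f (Inr (Some (\<nu> (Suc k))))" for k
    using inj_\<nu> \<nu>_in by (simp add: g_def)
  have gc: "continuous_map X euclidean (\<lambda>x. g (Inl x))"
  proof (rule continuous_map_eq)
    show "continuous_map X euclidean (\<lambda>x. - f (Inl (\<phi> x)))"
      using continuous_map_compose[OF cont_\<phi> cont_Inl[OF f]]
      by (auto intro: continuous_map_minus simp: o_def)
  qed (simp add: g_def)
  have "(\<lambda>k. f (Inr (Some (\<nu> (Suc k))))) \<longlonglongrightarrow> f (Inr None)"
    using f unfolding cfun_space_S_iff by (auto intro: LIMSEQ_Suc)
  then have g: "g \<in> cfun_space S"
    unfolding cfun_space_S_iff gs using gc by (simp add: g_def)
  \<comment> \<open>\<open>shift g\<close> agrees with \<open>f\<close> away from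
    \<open>\<nu> 0\<close>; \<open>?c\<close> is the discrepancy at this point.\<close>
  let ?c = "f (Inr (Some (\<nu> 0))) - \<Delta> (\<lambda>x. g (Inl x))"
  have "f - cfun_scale ?c ?e = f + cfun_scale (- ?c) ?e"
    by (auto simp: cfun_scale_def)
  then have in_E: "f - cfun_scale ?c ?e \<in> cfun_space S"
    by (simp only: add_in[OF f scale_in[OF e_in]])
  have "f - cfun_scale ?c ?e = shift g"
  proof (rule S_ext[OF in_E shift_in[OF g]])
    show "(f - cfun_scale ?c ?e) (Inl x) = shift g (Inl x)" if "x \<in> topspace X" for x
      using that by (simp add: cfun_scale_def g_def \<phi>\<psi> \<psi>_in)
    show "(f - cfun_scale ?c ?e) (Inr (Some (\<nu> k))) = shift g (Inr (Some (\<nu> k)))" for k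
      using inj_\<nu> by (cases k) (simp_all add: cfun_scale_def gs inj_eq)
  qed
  then show "\<exists>c. f - cfun_scale c ?e \<in> shift ` cfun_space S" using g by blast
qed

lemma funpow_\<phi>_in: "x \<in> topspace X \<Longrightarrow> (\<phi> ^^ n) x \<in> topspace X"
  by (induction n) (auto intro: \<phi>_in)

text \<open>Evaluating at the image under \<open>\<phi> ^^ n\<close> cancels the \<open>n\<close>
  applications of \<open>\<psi>\<close> and leaves only the sign.\<close>

lemma funpow_shift_Inl:
  "x \<in> topspace X \<Longrightarrow> (shift ^^ n) f (Inl ((\<phi> ^^ n) x)) = (- 1) ^ n * f (Inl x)"
  by (induction n) (simp_all add: funpow_\<phi>_in \<phi>_in \<psi>\<phi>)

text \<open>The first application puts \<open>\<Delta>\<close> of the restriction of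
  \<open>f\<close> at \<open>\<nu> 0\<close>, and the remaining \<open>k\<close> carry it unchanged
  to \<open>\<nu> k\<close>.\<close>

lemma funpow_shift_Inr: "(shift ^^ Suc k) f (Inr (Some (\<nu> k))) = \<Delta> (\<lambda>x. f (Inl x))"
proof -
  have "(shift ^^ k) g (Inr (Some (\<nu> k))) = g (Inr (Some (\<nu> 0)))" for g
    by (induction k) simp_all
  then show ?thesis unfolding funpow_Suc_right o_apply by (simp only: shift_simps)
qed

lemma shift_Inter: "(\<Inter>n\<in>{1..}. (shift ^^ n) ` cfun_space S) = {0}"
proof (intro equalityI subsetI)
  fix f assume "f \<in> (\<Inter>n\<in>{1..}. (shift ^^ n) ` cfun_space S)"
  then have f: "f \<in> (shift ^^ Suc k) ` cfun_space S" for k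
    by (rule INT_D) simp
  have fE: "f \<in> cfun_space S"
    using f[of 0] by (auto intro: shift_in)
  \<comment> \<open>A preimage \<open>g\<close> under the power \<open>Suc k\<close> determines both
    the value of \<open>f\<close> at \<open>\<nu> k\<close> and, up to sign, \<open>f\<close> along
    \<open>\<phi> ^^ Suc k\<close>. The sign is its own inverse, so \<open>g\<close> can be
    eliminated.\<close>
  have f_seq: "f (Inr (Some (\<nu> k))) = (-1) ^ Suc k * \<Delta> (\<lambda>x. f (Inl ((\<phi> ^^ Suc k) x)))" for k
  proof -
    obtain g where g: "g \<in> cfun_space S" and fg: "f = (shift ^^ Suc k) g"
      using f[of k] by (rule imageE)
    have "f (Inl ((\<phi> ^^ Suc k) x)) = (- 1) ^ Suc k * g (Inl x)" if "x \<in> topspace X" for x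
      unfolding fg by (rule funpow_shift_Inl[OF that])
    then have "\<Delta> (\<lambda>x. f (Inl ((\<phi> ^^ Suc k) x))) = \<Delta> (\<lambda>x. (- 1) ^ Suc k * g (Inl x))"
      by (rule \<Delta>_cong)
    also have "\<dots> = (- 1) ^ Suc k * \<Delta> (\<lambda>x. g (Inl x))"
      by (rule \<Delta>_scale[OF cont_Inl[OF g]])
    finally have "(-1) ^ Suc k * \<Delta> (\<lambda>x. f (Inl ((\<phi> ^^ Suc k) x))) = \<Delta> (\<lambda>x. g (Inl x))"
      by (simp only: left_minus_one_mult_self)
    then show ?thesis
      unfolding fg funpow_shift_Inr by simp
  qed
  \<comment> \<open>Continuity at infinity makes the values in \<open>f_seq\<close> converge. Up to
    a shift of the index by one this is the premise of \<open>\<Delta>_orbit\<close>, so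
    \<open>f\<close> vanishes on \<open>X\<close>, and then \<open>f_seq\<close> yields 0 at the
    isolated points as well.\<close>
  have "(\<lambda>k. f (Inr (Some (\<nu> k)))) \<longlonglongrightarrow> f (Inr None)"
    using fE by (simp add: cfun_space_S_iff)
  then have "(\<lambda>n. (-1) ^ n * \<Delta> (\<lambda>x. f (Inl ((\<phi> ^^ n) x)))) \<longlonglongrightarrow> f (Inr None)"
    unfolding f_seq by (rule LIMSEQ_imp_Suc)
  then have 0: "f (Inl x) = 0" if "x \<in> topspace X" for x
    using \<Delta>_orbit[OF cont_Inl[OF fE] _ that] by (auto simp: convergent_def)
  then have "\<Delta> (\<lambda>x. f (Inl ((\<phi> ^^ k) x))) = 0" for k
    using \<Delta>_cong[of "\<lambda>x. f (Inl ((\<phi> ^^ k) x))" "\<lambda>x. 0"] \<Delta>_0 by (simp add: funpow_\<phi>_in)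
  then have "f = 0"
    by (intro S_ext[OF fE zero_in]) (simp_all add: 0 f_seq del: power_Suc funpow.simps)
  then show "f \<in> {0}" by simp
next
  fix f :: "'a + 'n option \<Rightarrow> 'k" assume "f \<in> {0}"
  moreover have "shift 0 = 0"
    using shift_add[OF zero_in zero_in] by simp
  then have "(shift ^^ n) 0 = 0" for n by (induction n) auto
  ultimately show "f \<in> (\<Inter>n\<in>{1..}. (shift ^^ n) ` cfun_space S)"
    using zero_in by (auto simp: image_iff intro!: bexI[of _ 0])
qed

theorem admits_isometric_shift: "admits_isometric_shift TYPE('k) S"
  unfolding admits_isometric_shift_def isometric_shift_def
  by (intro exI[of _ shift] conjI ballI allI image_subsetI shift_in shift_add shift_scale
      sup_norm_shift shift_codim shift_Inter)

end

section \<open>Rational independence through factorial digits, and Kronecker approximation\<close>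

section \<open>Continuum many independent reals\<close>

text \<open>Let \<open>t m\<close> be the tail of the series from \<open>m\<close> on. Then
  \<open>t (Suc m) * fact m\<close> is an integer, since \<open>fact m\<close> clears the
  denominators of all earlier terms, and it is at most a constant divided by \<open>Suc m\<close>.
  So late tails vanish, and \<open>d m / fact m\<close> is a difference of two consecutive
  tails.\<close>

lemma eventually_zero_if_factorial_series_int:
  fixes d :: "nat \<Rightarrow> int" and a :: int
  assumes bd: "\<And>n. \<bar>d n\<bar> \<le> C" and sum: "(\<lambda>n. d n / fact n) sums a"
  shows "\<exists>M. \<forall>m\<ge>M. d m = 0"
proof -
  have summ: "summable (\<lambda>n. d n / fact n)" using sum by (simp add: sums_iff)
  have C: "0 \<le> C" using bd[of 0] by linarith
  have exp_summ: "summable (\<lambda>n. 1 / fact n :: real)"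
    using summable_exp[of "1::real"] by (simp add: inverse_eq_divide)
  define t where "t m = (\<Sum>n. d (n + m) / fact (n + m) :: real)" for m
  have t: "t m = a - (\<Sum>n<m. d n / fact n)" for m
    using suminf_minus_initial_segment[OF summ, of m] sum by (simp add: t_def sums_iff)
  have int: "t (Suc m) * fact m \<in> \<int>" for m
  proof -
    have "d n / fact n * fact m \<in> \<int>" if "n \<le> m" for n
    proof -
      have "(fact n :: nat) dvd fact m" using that by (rule fact_dvd)
      then obtain b :: nat where "fact m = fact n * b" by (auto simp: dvd_def)
      then have "(fact m :: real) = fact n * b" by (metis of_nat_fact of_nat_mult)
      then have "d n / fact n * fact m = of_int (d n * int b)" by simp
      then show ?thesis by (metis Ints_of_int)
    qed
    then have "(\<Sum>n<Suc m. d n / fact n * fact m) \<in> \<int>"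
      by (intro Ints_sum) auto
    moreover have "(fact m :: real) \<in> \<int>" by (metis Ints_of_nat of_nat_fact)
    ultimately show ?thesis
      unfolding t left_diff_distrib sum_distrib_right by (intro Ints_diff Ints_mult) auto
  qed
  have small: "\<bar>t (Suc m) * fact m\<bar> \<le> C * (\<Sum>n. 1 / fact n) / Suc m" for m
  proof -
    have le: "\<bar>d (n + Suc m) / fact (n + Suc m) * fact m\<bar> \<le> C / Suc m * (1 / fact n)" for n
    proof -
      \<comment> \<open>This comparison bounds the tail by the exponential series and leaves a
        factor \<open>1 / Suc m\<close> to spare.\<close>
      have "fact (Suc m) * fact n \<le> (fact (n + Suc m) :: nat)"
        using fact_fact_dvd_fact[of "Suc m" n, where 'a = nat] by (intro dvd_imp_le) (auto simp: add.commute)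
      then have f: "fact (Suc m) * fact n \<le> (fact (n + Suc m) :: real)"
        by (metis of_nat_fact of_nat_le_iff of_nat_mult)
      have "\<bar>d (n + Suc m) / fact (n + Suc m) * fact m\<bar> = \<bar>d (n + Suc m)\<bar> * fact m / fact (n + Suc m)"
        by (simp add: abs_mult)
      also have "\<dots> \<le> C * fact m / (fact (Suc m) * fact n)"
        using bd[of "n + Suc m"] C f by (intro frac_le mult_right_mono mult_nonneg_nonneg) auto
      also have "\<dots> = C / Suc m * (1 / fact n)"
        by (simp del: of_nat_Suc)
      finally show ?thesis .
    qed
    have "\<bar>t (Suc m) * fact m\<bar> = \<bar>\<Sum>n. d (n + Suc m) / fact (n + Suc m) * fact m\<bar>"
      unfolding t_def using summ
      by (subst suminf_mult2) (simp_all only: summable_iff_shift[of "\<lambda>n. d n / fact n" "Suc m"])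
    also have "\<dots> \<le> (\<Sum>n. C / Suc m * (1 / fact n))"
    proof -
      have s: "summable (\<lambda>n. C / Suc m * (1 / fact n) :: real)" by (intro summable_mult exp_summ)
      have "summable (\<lambda>n. \<bar>d (n + Suc m) / fact (n + Suc m) * fact m\<bar>)"
        by (rule summable_comparison_test'[OF s, of 0]) (use le in auto)
      then show ?thesis
        by (intro order_trans[OF summable_rabs] suminf_le le s) auto
    qed
    also have "\<dots> = C * (\<Sum>n. 1 / fact n) / Suc m"
      using suminf_mult[OF exp_summ, of "C / Suc m"] by simp
    finally show ?thesis .
  qed
  obtain M :: nat where M: "C * (\<Sum>n. 1 / fact n) < real M"
    using reals_Archimedean2 by blast
  have t0: "t (Suc m) = 0" if "m \<ge> M" for m
  proof -
    have "\<bar>t (Suc m) * fact m\<bar> < 1"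
      by (rule le_less_trans[OF small]) (use M that in \<open>simp add: field_simps\<close>)
    then have "t (Suc m) * fact m = 0"
      using int[of m] by (metis Ints_nonzero_abs_less1)
    then show ?thesis by simp
  qed
  have "d m = 0" if "m \<ge> Suc M" for m
  proof -
    obtain k where k: "m = Suc k" "k \<ge> M" using \<open>m \<ge> Suc M\<close> Suc_le_D by auto
    have "t (Suc k) - t (Suc m) = d m / fact m"
      unfolding t k by simp
    then show ?thesis using t0[of k] t0[of m] k by simp
  qed
  then show ?thesis by blast
qed

text \<open>Almost disjoint sets of digit positions give numbers independent over the rationals, because a
  bounded digit sequence with respect to the denominators \<open>n!\<close> can only represent an integer if it is
  eventually zero.\<close>

definition floor_graph :: "real \<Rightarrow> nat set" where
  "floor_graph x = range (\<lambda>k. prod_encode (k, int_encode \<lfloor>x * real k\<rfloor>))"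

text \<open>For \<open>y \<noteq> x\<close> the numbers \<open>x * k\<close> and
  \<open>y * k\<close> are more than 1 apart for all large \<open>k\<close>, so their floors differ.
  Each element of a graph encodes its argument \<open>k\<close>, hence one large \<open>k\<close>
  separates \<open>x\<close> from all other members of \<open>F\<close>.\<close>

lemma floor_graph_almost_disjoint:
  assumes "finite F" "x \<in> F"
  shows "\<exists>n\<ge>m. n \<in> floor_graph x \<and> (\<forall>y\<in>F. n \<in> floor_graph y \<longrightarrow> y = x)"
proof -
  have "\<forall>y\<in>F. \<forall>\<^sub>F k in sequentially. \<lfloor>y * real k\<rfloor> = \<lfloor>x * real k\<rfloor> \<longrightarrow> y = x"
  proof
    fix y assume "y \<in> F"
    show "\<forall>\<^sub>F k in sequentially. \<lfloor>y * real k\<rfloor> = \<lfloor>x * real k\<rfloor> \<longrightarrow> y = x"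
    proof (cases "y = x")
      case False
      obtain K :: nat where "1 / \<bar>x - y\<bar> < real K" using reals_Archimedean2 by blast
      then have K: "1 < \<bar>x - y\<bar> * K" using False by (simp add: field_simps)
      have "\<lfloor>y * real k\<rfloor> \<noteq> \<lfloor>x * real k\<rfloor>" if "k \<ge> K" for k
      proof -
        have "\<bar>x - y\<bar> * K \<le> \<bar>x - y\<bar> * k" using that by (intro mult_left_mono) auto
        then have "1 < \<bar>x * k - y * k\<bar>" using K by (simp add: abs_mult left_diff_distrib[symmetric])
        then show ?thesis by linarith
      qed
      then show ?thesis unfolding eventually_sequentially by blast
    qed auto
  qed
  then have "\<forall>\<^sub>F k in sequentially. \<forall>y\<in>F. \<lfloor>y * real k\<rfloor> = \<lfloor>x * real k\<rfloor> \<longrightarrow> y = x"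
    using assms(1) by (simp add: eventually_ball_finite_distrib)
  then obtain k where k: "k \<ge> m" "\<And>y. y \<in> F \<Longrightarrow> \<lfloor>y * real k\<rfloor> = \<lfloor>x * real k\<rfloor> \<Longrightarrow> y = x"
    unfolding eventually_sequentially by (metis linear)
  show ?thesis
  proof (intro exI conjI ballI impI)
    let ?n = "prod_encode (k, int_encode \<lfloor>x * real k\<rfloor>)"
    show "m \<le> ?n" using k(1) le_prod_encode_1 order_trans by blast
    show "?n \<in> floor_graph x" by (auto simp: floor_graph_def)
    show "y = x" if "y \<in> F" "?n \<in> floor_graph y" for y
      using that k(2)[of y] by (auto simp: floor_graph_def inj_eq[OF inj_int_encode])
  qed
qed

definition indep_real :: "real \<Rightarrow> real" where
  "indep_real x = (\<Sum>n. of_bool (n \<in> floor_graph x) / fact n)"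

lemma indep_real_sums: "(\<lambda>n. of_bool (n \<in> floor_graph x) / fact n) sums indep_real x"
  unfolding indep_real_def
proof (rule summable_sums, rule summable_comparison_test')
  show "summable (\<lambda>n. 1 / fact n :: real)"
    using summable_exp[of "1::real"] by (simp add: inverse_eq_divide)
qed auto

text \<open>The combination has a factorial series with digits \<open>d n\<close>, bounded by the
  sum of the absolute coefficients, so these digits are eventually 0. At a late position that
  belongs to the graph of \<open>x\<close> only, the digit is \<open>c x\<close>.\<close>

lemma indep_real_independent:
  fixes c :: "real \<Rightarrow> int" and a :: int
  assumes F: "finite F" and eq: "(\<Sum>x\<in>F. c x * indep_real x) = a" and x: "x \<in> F"
  shows "c x = 0"
proof -
  define d where "d n = (\<Sum>x\<in>F. c x * of_bool (n \<in> floor_graph x))" for n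
  have "(\<lambda>n. \<Sum>x\<in>F. c x * (of_bool (n \<in> floor_graph x) / fact n)) sums (\<Sum>x\<in>F. c x * indep_real x)"
    by (intro sums_sum sums_mult indep_real_sums)
  moreover have "(\<Sum>x\<in>F. c x * (of_bool (n \<in> floor_graph x) / fact n)) = d n / fact n" for n
    by (simp add: d_def sum_divide_distrib)
  ultimately have sums: "(\<lambda>n. d n / fact n) sums a" by (simp add: eq)
  have bd: "\<bar>d n\<bar> \<le> (\<Sum>x\<in>F. \<bar>c x\<bar>)" for n
    unfolding d_def by (rule order_trans[OF sum_abs]) (auto intro!: sum_mono)
  obtain M where M: "\<And>m. m \<ge> M \<Longrightarrow> d m = 0"
    using eventually_zero_if_factorial_series_int[OF bd sums] by auto
  have "\<exists>n\<ge>M. n \<in> floor_graph x \<and> (\<forall>y\<in>F. n \<in> floor_graph y \<longrightarrow> y = x)"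
    by (rule floor_graph_almost_disjoint[OF F x])
  then obtain n where n1: "n \<ge> M" and n2: "n \<in> floor_graph x"
    and n3: "\<forall>y\<in>F. n \<in> floor_graph y \<longrightarrow> y = x"
    by (elim exE conjE)
  have "c y * of_bool (n \<in> floor_graph y) = (if y = x then c x else 0)" if "y \<in> F" for y
    using n2 bspec[OF n3 that] by (cases "y = x") simp_all
  then have "d n = (\<Sum>y\<in>F. if y = x then c x else 0)"
    unfolding d_def by (rule sum.cong[OF refl])
  also have "\<dots> = c x"
    using F x by (simp only: sum.delta' sum.delta if_True)
  finally show ?thesis using M[OF n1] by simp
qed

lemma inj_indep_real: "inj indep_real"
proof (rule injI, rule ccontr)
  fix x y :: real assume eq: "indep_real x = indep_real y" and neq: "x \<noteq> y"
  have "(\<Sum>z\<in>{x, y}. of_int (if z = x then 1 else - 1) * indep_real z) = of_int 0"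
    using eq neq by simp
  from indep_real_independent[OF _ this, of x] show False by simp
qed

lemma indep_real_neq_1: "indep_real x \<noteq> 1"
proof
  assume "indep_real x = 1"
  then have "(\<Sum>z\<in>{x}. of_int 1 * indep_real z) = of_int 1" by simp
  from indep_real_independent[OF _ this, of x] show False by simp
qed

text \<open>Kronecker's theorem supplies an integer \<open>k\<close> without control of its size or
  sign. A simultaneous Dirichlet approximation gives \<open>q > 0\<close> with all
  \<open>q * \<theta> i\<close> almost integral, and adding a large multiple of \<open>q\<close> to
  \<open>k\<close> passes \<open>L\<close> at small cost.\<close>

lemma indep_real_Kronecker_int:
  assumes F: "finite F" and "\<epsilon> > 0"
  shows "\<exists>k::int. \<exists>h::real \<Rightarrow> int. int L \<le> k \<and> (\<forall>x\<in>F. \<bar>k * indep_real x - h x - \<alpha> x\<bar> < \<epsilon>)"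
proof -
  let ?s = "\<lambda>(r::int) (x::real). of_int r * x"
  interpret m: Modules.module ?s
    by (simp add: Modules.module.intro distrib_left distrib_right)
  define n where "n = card F"
  obtain f where f: "bij_betw f {..<n} F"
    using ex_bij_betw_nat_finite[OF F] by (auto simp: n_def atLeast0LessThan)
  \<comment> \<open>The entry with index \<open>n\<close> is 1: the form of Kronecker's theorem
    applied below asks for independence together with 1.\<close>
  define \<theta> where "\<theta> i = (if i < n then indep_real (f i) else 1)" for i
  have f_inj: "f i = f j \<longleftrightarrow> i = j" if "i < n" "j < n" for i j
    using f that by (auto simp: bij_betw_def inj_on_def)
  have inj: "inj_on \<theta> {..n}"
    using indep_real_neq_1 indep_real_neq_1[symmetric] f_inj
    by (auto simp: inj_on_def \<theta>_def inj_eq[OF inj_indep_real])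
  have indep: "m.independent (\<theta> ` {..n})"
  proof
    assume "m.dependent (\<theta> ` {..n})"
    then obtain u :: "real \<Rightarrow> int" where u: "\<exists>v\<in>\<theta> ` {..n}. u v \<noteq> 0" "(\<Sum>v\<in>\<theta> ` {..n}. u v * v) = 0"
      using m.dependent_finite[of "\<theta> ` {..n}"] by auto
    have "0 = (\<Sum>i\<le>n. u (\<theta> i) * \<theta> i)"
      using u(2) by (simp add: sum.reindex[OF inj])
    also have "\<dots> = (\<Sum>i<n. u (indep_real (f i)) * indep_real (f i)) + u 1"
      by (simp add: lessThan_Suc_atMost[symmetric] \<theta>_def)
    also have "(\<Sum>i<n. u (indep_real (f i)) * indep_real (f i)) = (\<Sum>x\<in>F. u (indep_real x) * indep_real x)"
      by (rule sum.reindex_bij_betw[OF f])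
    finally have eq: "(\<Sum>x\<in>F. u (indep_real x) * indep_real x) = of_int (- u 1)" by simp
    then have 0: "u (indep_real x) = 0" if "x \<in> F" for x
      using indep_real_independent[OF F eq that] by simp
    then have "u 1 = 0" using eq by simp
    moreover have "f i \<in> F" if "i < n" for i using f that by (auto simp: bij_betw_def)
    ultimately have "u (\<theta> i) = 0" for i
      using 0 by (simp add: \<theta>_def)
    then show False using u(1) by auto
  qed
  obtain k m where k: "\<And>i. i < n \<Longrightarrow> \<bar>of_int k * \<theta> i - of_int (m i) - \<alpha> (f i)\<bar> < \<epsilon> / 2"
    using Kronecker_thm_2[OF indep inj, of "\<epsilon> / 2" "\<lambda>i. \<alpha> (f i)"] \<open>\<epsilon> > 0\<close> by (auto simp: \<theta>_def)
  \<comment> \<open>As \<open>q\<close> is at least 1, \<open>k + l * q\<close> is at least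
    \<open>L\<close>. The choice of \<open>D\<close> keeps the accumulated error
    \<open>l / D\<close> below \<open>\<epsilon> / 2\<close>.\<close>
  define l where "l = nat \<bar>k\<bar> + L"
  obtain D :: nat where D: "real l * 2 / \<epsilon> < D" using reals_Archimedean2 by blast
  then have "D > 0" using \<open>\<epsilon> > 0\<close> by (metis divide_nonneg_pos gr0I less_le_not_le mult_nonneg_nonneg of_nat_0 of_nat_0_le_iff zero_le_numeral)
  obtain q p where q: "0 < q" "\<And>i. i < n \<Longrightarrow> \<bar>of_int q * \<theta> i - of_int (p i)\<bar> < 1 / D"
    using Dirichlet_approx_simult[OF \<open>D > 0\<close>] by metis
  show ?thesis
  proof (intro exI conjI ballI)
    have "int l * 1 \<le> int l * q" using q(1) by (intro mult_left_mono) auto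
    then show "int L \<le> k + l * q" by (simp add: l_def)
    fix x assume "x \<in> F"
    then obtain i where i: "i < n" "f i = x" using f by (auto simp: bij_betw_def)
    have inv: "the_inv_into {..<n} f x = i"
      using i f by (auto simp: bij_betw_def intro!: the_inv_into_f_eq)
    have "\<bar>l * (of_int q * \<theta> i - of_int (p i))\<bar> \<le> l * (1 / D)"
      unfolding abs_mult using q(2)[OF i(1)] by (intro mult_mono) auto
    also have "\<dots> \<le> \<epsilon> / 2" using D \<open>D > 0\<close> \<open>\<epsilon> > 0\<close> by (simp add: field_simps)
    finally have "\<bar>l * (of_int q * \<theta> i - of_int (p i))\<bar> \<le> \<epsilon> / 2" .
    then have "\<bar>(of_int k * \<theta> i - of_int (m i) - \<alpha> (f i)) + l * (of_int q * \<theta> i - of_int (p i))\<bar> < \<epsilon>"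
      using k[OF i(1)] by linarith
    then show "\<bar>(k + l * q) * indep_real x -
        (\<lambda>x. m (the_inv_into {..<n} f x) + l * p (the_inv_into {..<n} f x)) x - \<alpha> x\<bar> < \<epsilon>"
      using i inv by (simp add: \<theta>_def algebra_simps)
  qed
qed

text \<open>The parity is prescribed by writing \<open>n = 2 * k + r\<close> with \<open>r\<close>
  equal to 0 or 1: the targets \<open>(\<alpha> x - r * indep_real x) / 2\<close> are approximated
  with multiplier \<open>k\<close>, and everything is doubled.\<close>

lemma indep_real_Kronecker:
  assumes F: "finite F" and "\<epsilon> > 0"
  shows "\<exists>n\<ge>L::nat. (even n \<longleftrightarrow> b) \<and> (\<exists>h::real \<Rightarrow> int. \<forall>x\<in>F. \<bar>n * indep_real x - h x - \<alpha> x\<bar> < \<epsilon>)"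
proof -
  define r :: int where "r = of_bool (\<not> b)"
  obtain k h where k: "int L \<le> k"
    "\<And>x. x \<in> F \<Longrightarrow> \<bar>k * indep_real x - of_int (h x) - (\<alpha> x - r * indep_real x) / 2\<bar> < \<epsilon> / 2"
    using indep_real_Kronecker_int[OF F, of "\<epsilon> / 2" L "\<lambda>x. (\<alpha> x - r * indep_real x) / 2"] \<open>\<epsilon> > 0\<close> by auto
  define n where "n = nat (2 * k + r)"
  have n: "int n = 2 * k + r" using k(1) by (simp add: n_def r_def)
  have "int L \<le> int n" using k(1) unfolding n by (simp add: r_def)
  moreover have "even (int n) \<longleftrightarrow> b" unfolding n by (simp add: r_def)
  moreover have "\<bar>n * indep_real x - of_int (2 * h x) - \<alpha> x\<bar> < \<epsilon>" if "x \<in> F" for x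
  proof -
    have "real n = 2 * k + r" using n by (metis of_int_add of_int_mult of_int_numeral of_int_of_nat_eq)
    then have eq: "n * indep_real x - of_int (2 * h x) - \<alpha> x =
        2 * (k * indep_real x - of_int (h x) - (\<alpha> x - r * indep_real x) / 2)"
      by (simp add: field_simps)
    show ?thesis
      unfolding eq abs_mult using k(2)[OF that] by simp
  qed
  ultimately show ?thesis by (intro exI[of _ n]) (auto intro!: exI[of _ "\<lambda>x. 2 * h x"])
qed

section \<open>Null sets on the circle and on the line, and invariance under rotations\<close>

section \<open>Measure theory on the circle\<close>

text \<open>A set of the completed sigma-algebra is \<open>S \<union> N\<close> with
  \<open>N\<close> inside a null set \<open>N'\<close>. Measurability of \<open>T\<close> handles
  \<open>S\<close>, and for \<open>N\<close> it is enough that the preimage of \<open>N'\<close> is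
  null.\<close>

lemma
  assumes T: "T \<in> M \<rightarrow>\<^sub>M M'"
    and null: "\<And>N. N \<in> null_sets M' \<Longrightarrow> T -` N \<inter> space M \<in> null_sets M"
  shows measurable_completion_completion: "T \<in> completion M \<rightarrow>\<^sub>M completion M'"
    and AE_completion_vimage: "AE y in completion M'. P y \<Longrightarrow> AE x in completion M. P (T x)"
proof -
  show "T \<in> completion M \<rightarrow>\<^sub>M completion M'"
  proof (rule measurableI)
    show "T x \<in> space (completion M')" if "x \<in> space (completion M)" for x
      using that measurable_space[OF T] by simp
    fix A assume "A \<in> sets (completion M')"
    then obtain S N N' where A: "A = S \<union> N" "N \<subseteq> N'" "N' \<in> null_sets M'" "S \<in> sets M'"
      by (rule sets_completionE)
    show "T -` A \<inter> space (completion M) \<in> sets (completion M)"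
    proof (rule sets_completionI)
      show "T -` A \<inter> space (completion M) = (T -` S \<inter> space M) \<union> (T -` N \<inter> space M)"
        using A by auto
      show "T -` N \<inter> space M \<subseteq> T -` N' \<inter> space M" using A by auto
      show "T -` N' \<inter> space M \<in> null_sets M" using A null by auto
      show "T -` S \<inter> space M \<in> sets M" using A T by (auto intro: measurable_sets)
    qed
  qed
  show "AE x in completion M. P (T x)" if "AE y in completion M'. P y"
  proof -
    from that obtain N where "{y \<in> space M'. \<not> P y} \<subseteq> N" "N \<in> null_sets M'"
      unfolding AE_completion_iff by (auto simp: eventually_ae_filter)
    then have "T -` N \<inter> space M \<in> null_sets M" "{x \<in> space M. \<not> P (T x)} \<subseteq> T -` N \<inter> space M"
      using measurable_space[OF T] null by auto
    then show ?thesis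
      unfolding AE_completion_iff by (rule AE_I')
  qed
qed

abbreviation "circle_borel \<equiv>
  distr (restrict_space lborel {0..<2 * pi}) (restrict_space borel (sphere 0 1)) cis"

lemma space_circle_borel: "space circle_borel = sphere 0 1"
  by (simp add: space_restrict_space)

lemma measurable_cis_line: "cis \<in> lborel \<rightarrow>\<^sub>M circle_borel"
  by (auto simp: cis_conv_exp intro!: measurable_restrict_space2 borel_measurable_continuous_onI
      continuous_intros)

text \<open>The measure sees a single period, but countably many translates of that period by
  multiples of \<open>2 * pi\<close> cover the whole preimage under \<open>cis\<close>. With the
  whole preimage, rotations of the circle become translations of the line.\<close>

lemma null_sets_circle_borel_iff:
  assumes A: "A \<in> sets circle_borel"
  shows "A \<in> null_sets circle_borel \<longleftrightarrow> negligible (cis -` A)"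
proof -
  let ?E = "cis -` A \<inter> {0..<2 * pi}"
  have meas: "cis -` A \<in> sets lborel"
    using measurable_sets[OF measurable_cis_line A] by simp
  then have E: "?E \<in> sets lborel" by auto
  have "emeasure circle_borel A = emeasure (restrict_space lborel {0..<2 * pi}) ?E"
    using A by (subst emeasure_distr[OF measurable_cis_circle]) (auto simp: space_restrict_space)
  also have "\<dots> = emeasure lborel ?E"
    by (rule emeasure_restrict_space) auto
  finally have "A \<in> null_sets circle_borel \<longleftrightarrow> ?E \<in> null_sets lborel"
    using A E by (auto simp: null_sets_def)
  also have "\<dots> \<longleftrightarrow> negligible ?E"
    using E by (simp add: negligible_iff_null_sets null_sets_completion_iff)
  also have "\<dots> \<longleftrightarrow> negligible (cis -` A)"
  proof
    assume neg: "negligible ?E"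
    have "cis -` A \<subseteq> (\<Union>k::int. (+) (2 * pi * k) ` ?E)"
    proof
      fix t assume t: "t \<in> cis -` A"
      define k where "k = \<lfloor>t / (2 * pi)\<rfloor>"
      have "2 * pi * k \<le> t" "t < 2 * pi * (k + 1)"
        using floor_divide_lower[of "2 * pi" t] floor_divide_upper[of "2 * pi" t]
        by (simp_all add: k_def mult.commute)
      moreover have "cis (t - 2 * pi * k) = cis t"
        by (metis cis_divide cis_multiple_2pi div_by_1 Ints_of_int)
      ultimately have "t - 2 * pi * k \<in> ?E" using t by (simp add: algebra_simps)
      then show "t \<in> (\<Union>k::int. (+) (2 * pi * k) ` ?E)" by force
    qed
    moreover have "negligible (\<Union>k::int. (+) (2 * pi * k) ` ?E)"
      using neg by (intro negligible_countable_Union) (auto intro: negligible_translation)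
    ultimately show "negligible (cis -` A)" by (rule negligible_subset[rotated])
  qed (auto intro: negligible_subset)
  finally show ?thesis .
qed

lemma null_sets_circle_borel_cis:
  assumes "A \<in> null_sets circle_borel" shows "cis -` A \<inter> space lborel \<in> null_sets lborel"
proof -
  have "cis -` A \<in> sets lborel"
    using measurable_sets[OF measurable_cis_line, of A] assms by auto
  moreover have "negligible (cis -` A)"
    using assms null_sets_circle_borel_iff by blast
  ultimately show ?thesis
    by (simp add: negligible_iff_null_sets null_sets_completion_iff)
qed

lemma measurable_cis_lebesgue: "cis \<in> lebesgue \<rightarrow>\<^sub>M circle_lebesgue"
  unfolding circle_lebesgue_def
  by (rule measurable_completion_completion[OF measurable_cis_line null_sets_circle_borel_cis])

lemma AE_cis_lebesgue: "AE z in circle_lebesgue. P z \<Longrightarrow> AE t in lebesgue. P (cis t)"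
  unfolding circle_lebesgue_def
  by (rule AE_completion_vimage[OF measurable_cis_line null_sets_circle_borel_cis])

lemma measurable_rotation: "(\<lambda>z. cis s * z) \<in> circle_borel \<rightarrow>\<^sub>M circle_borel"
proof -
  have "(\<lambda>z. cis s * z) \<in> restrict_space borel (sphere 0 1) \<rightarrow>\<^sub>M restrict_space borel (sphere 0 1)"
    by (intro measurable_restrict_space3 borel_measurable_continuous_onI continuous_intros)
      (auto simp: norm_mult)
  then show ?thesis by simp
qed

text \<open>On the line the rotation by \<open>cis s\<close> translates the preimage by
  \<open>- s\<close>, and translations preserve negligibility.\<close>

lemma null_sets_rotation:
  assumes "A \<in> null_sets circle_borel"
  shows "(\<lambda>z. cis s * z) -` A \<inter> space circle_borel \<in> null_sets circle_borel"
proof (subst null_sets_circle_borel_iff)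
  show "(\<lambda>z. cis s * z) -` A \<inter> space circle_borel \<in> sets circle_borel"
    using assms by (intro measurable_sets[OF measurable_rotation]) auto
  have "cis -` ((\<lambda>z. cis s * z) -` A \<inter> space circle_borel) = (+) (- s) ` (cis -` A)"
  proof (intro set_eqI iffI)
    fix t assume "t \<in> cis -` ((\<lambda>z. cis s * z) -` A \<inter> space circle_borel)"
    then have "s + t \<in> cis -` A" by (simp add: cis_mult)
    then show "t \<in> (+) (- s) ` (cis -` A)" by force
  next
    fix t assume "t \<in> (+) (- s) ` (cis -` A)"
    then show "t \<in> cis -` ((\<lambda>z. cis s * z) -` A \<inter> space circle_borel)"
      unfolding space_circle_borel by (auto simp: cis_mult)
  qed
  moreover have "negligible (cis -` A)"
    using assms null_sets_circle_borel_iff by blast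
  ultimately show "negligible (cis -` ((\<lambda>z. cis s * z) -` A \<inter> space circle_borel))"
    by (simp only: negligible_translation)
qed

lemma measurable_rotation_lebesgue: "(\<lambda>z. cis s * z) \<in> circle_lebesgue \<rightarrow>\<^sub>M circle_lebesgue"
  unfolding circle_lebesgue_def
  by (rule measurable_completion_completion[OF measurable_rotation null_sets_rotation])

lemma AE_rotation_lebesgue:
  "AE z in circle_lebesgue. P z \<Longrightarrow> AE z in circle_lebesgue. P (cis s * z)"
  unfolding circle_lebesgue_def
  by (rule AE_completion_vimage[OF measurable_rotation null_sets_rotation])

lemma ess_bounded_rotation: "ess_bounded f \<Longrightarrow> ess_bounded (\<lambda>z. f (cis s * z))"
  unfolding ess_bounded_def
  using measurable_compose[OF measurable_rotation_lebesgue] AE_rotation_lebesgue by blast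

text \<open>\<open>null_sets_circle_borel_iff\<close> speaks of the uncompleted sigma-algebra only.
  The exceptional set is therefore replaced by its \<open>main_part\<close>, a subset in that
  sigma-algebra with the same measure.\<close>

lemma AE_circle_if_AE_line:
  assumes f: "f \<in> borel_measurable circle_lebesgue" and ae: "AE t in lebesgue. f (cis t) = (0::complex)"
  shows "AE z in circle_lebesgue. f z = 0"
proof -
  let ?A = "{z \<in> space circle_lebesgue. f z \<noteq> 0}"
  have A: "?A \<in> sets (completion circle_borel)"
    using f unfolding circle_lebesgue_def by measurable
  define B where "B = main_part circle_borel ?A"
  have B: "B \<in> sets circle_borel" "B \<subseteq> ?A"
    using main_part_sets[OF A] main_part_null_part_Un[OF A] unfolding B_def by blast+
  have "cis -` B \<subseteq> {t. f (cis t) \<noteq> 0}" using B by auto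
  moreover have "negligible {t. f (cis t) \<noteq> 0}"
    using ae by (simp add: negligible_iff_null_sets completion.AE_iff_null_sets)
  ultimately have "negligible (cis -` B)" by (rule negligible_subset[rotated])
  then have "B \<in> null_sets circle_borel"
    using B null_sets_circle_borel_iff by blast
  then have "emeasure (completion circle_borel) ?A = 0"
    using A by (auto simp: B_def[symmetric] null_sets_def)
  then have "?A \<in> null_sets circle_lebesgue"
    using A by (simp add: null_sets_def circle_lebesgue_def)
  then show ?thesis
    by (intro AE_I'[of ?A]) auto
qed

section \<open>Half-line integrals against an exponential weight\<close>

subsection \<open>An exponentially weighted mean along the circle\<close>

text \<open>Closed half lines are stable under intersection and generate the Borel sets. A Dynkin
  argument makes the integral vanish over all Borel sets and then, up to null sets, over all
  Lebesgue sets, which forces the function to be 0 almost everywhere.\<close>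

lemma AE_0_if_integrals_Ici_0:
  fixes w :: "real \<Rightarrow> complex"
  assumes int: "set_integrable lebesgue {c..} w"
    and 0: "\<And>s. c \<le> s \<Longrightarrow> (LINT t:{s..}|lebesgue. w t) = 0"
  shows "AE t in lebesgue. c \<le> t \<longrightarrow> w t = 0"
proof -
  \<comment> \<open>Cutting \<open>w\<close> off below \<open>c\<close> gives an integrable function
    on the line, whose integrals over half lines starting below \<open>c\<close> vanish too.\<close>
  define v where "v t = indicat_real {c..} t *\<^sub>R w t" for t
  have v: "integrable lebesgue v"
    using int unfolding set_integrable_def v_def .
  have sv: "set_integrable lebesgue A v" if "A \<in> sets lebesgue" for A
    using integrable_mult_indicator[OF that v] by (simp add: set_integrable_def)
  have Ici: "(LINT t:{s..}|lebesgue. v t) = 0" for s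
  proof -
    have "(LINT t:{s..}|lebesgue. v t) = (LINT t:{max s c..}|lebesgue. w t)"
      unfolding set_lebesgue_integral_def v_def
      by (rule Bochner_Integration.integral_cong) (auto simp: indicator_def)
    then show ?thesis using 0 by simp
  qed
  \<comment> \<open>The complement step of the Dynkin argument needs the integral over the whole
    line.\<close>
  have tot: "(LINT t|lebesgue. v t) = 0"
  proof -
    have "(LINT t|lebesgue. v t) = (LINT t:{c..}|lebesgue. v t)"
      unfolding set_lebesgue_integral_def v_def
      by (rule Bochner_Integration.integral_cong) (auto simp: indicator_def)
    then show ?thesis using Ici by simp
  qed
  have sigma_sets_Ici: "sigma_sets UNIV (range (\<lambda>x::real. {x..})) = sets borel"
    by (subst borel_Ici) simp
  have borel: "(LINT t:A|lebesgue. v t) = 0" if "A \<in> sets borel" for A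
  proof -
    have "{a..} \<inter> {b..} = {max a b..}" for a b :: real by auto
    then have "Int_stable (range (\<lambda>x::real. {x..}))" "range (\<lambda>x::real. {x..}) \<subseteq> Pow UNIV"
      "A \<in> sigma_sets UNIV (range (\<lambda>x::real. {x..}))"
      using that by (auto simp: Int_stable_def sigma_sets_Ici)
    then show ?thesis
    proof (induction rule: sigma_sets_induct_disjoint)
      case (basic A)
      then show ?case using Ici by auto
    next
      case empty
      show ?case by (simp add: set_lebesgue_integral_def)
    next
      case (compl A)
      then have A: "A \<in> sets lebesgue"
        unfolding sigma_sets_Ici by simp
      have "(LINT t:UNIV - A|lebesgue. v t) = (LINT t|lebesgue. v t - indicator A t *\<^sub>R v t)"
        unfolding set_lebesgue_integral_def
        by (rule Bochner_Integration.integral_cong) (auto simp: indicator_def)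
      also have "\<dots> = (LINT t|lebesgue. v t) - (LINT t:A|lebesgue. v t)"
        using v sv[OF A] unfolding set_lebesgue_integral_def set_integrable_def by simp
      finally show ?case using tot compl by simp
    next
      case (union A)
      then have "A i \<in> sigma_sets UNIV (range (\<lambda>x. {x..}))" for i by auto
      then have A: "A i \<in> sets lebesgue" for i
        unfolding sigma_sets_Ici by simp
      then have "(LINT t:(\<Union>i. A i)|lebesgue. v t) = (\<Sum>i. (LINT t:A i|lebesgue. v t))"
        using union(1) by (intro lebesgue_integral_countable_add sv) (auto simp: disjoint_family_on_def)
      then show ?case using union(3) by simp
    qed
  qed
  have "AE t in lebesgue. v t = 0"
  proof (rule sigma_finite_measure.density_zero[OF _ v])
    show "sigma_finite_measure (lebesgue :: real measure)"
    proof
      obtain A :: "real set set" where A: "countable A" "A \<subseteq> sets lborel" "\<Union>A = space lborel"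
          "\<forall>a\<in>A. emeasure lborel a \<noteq> \<infinity>"
        using lborel.sigma_finite_countable by blast
      then have "\<forall>a\<in>A. emeasure lebesgue a \<noteq> \<infinity>" by (auto simp: subset_eq)
      then show "\<exists>A::real set set. countable A \<and> A \<subseteq> sets lebesgue \<and> \<Union>A = space lebesgue \<and>
          (\<forall>a\<in>A. emeasure lebesgue a \<noteq> \<infinity>)"
        using A by (intro exI[of _ A]) auto
    qed
    fix A :: "real set" assume "A \<in> sets lebesgue"
    then obtain S N N' where A: "A = S \<union> N" "N \<subseteq> N'" "N' \<in> null_sets lborel" "S \<in> sets lborel"
      by (rule sets_completionE)
    have "N' \<in> null_sets lebesgue" using A(3) by (rule null_sets_completionI)
    then have "AE t in lebesgue. t \<notin> N'" by (rule AE_not_in)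
    then have "AE t in lebesgue. indicat_real A t *\<^sub>R v t = indicat_real S t *\<^sub>R v t"
      by eventually_elim (use A in \<open>auto simp: indicator_def\<close>)
    then have "(LINT t:A|lebesgue. v t) = (LINT t:S|lebesgue. v t)"
      unfolding set_lebesgue_integral_def
    proof (rule integral_cong_AE[rotated -1])
      have "S \<in> sets lebesgue" using A(4) by (rule sets_completionI_sets)
      then show "(\<lambda>t. indicat_real A t *\<^sub>R v t) \<in> borel_measurable lebesgue"
        "(\<lambda>t. indicat_real S t *\<^sub>R v t) \<in> borel_measurable lebesgue"
        using \<open>A \<in> sets lebesgue\<close> v
        by (auto intro!: borel_measurable_scaleR borel_measurable_indicator)
    qed
    then show "(LINT t:A|lebesgue. v t) = 0" using borel A(4) by simp
  qed
  then show ?thesis by eventually_elim (auto simp: v_def)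
qed

text \<open>For bounded \<open>f\<close> this is the mean against the density
  \<open>exp (- t) / (1 - exp (- 2 * pi))\<close> on one period. Unrolled to a half line, a rotation
  of \<open>f\<close> only moves the endpoint.\<close>

definition circle_laplace :: "(complex \<Rightarrow> complex) \<Rightarrow> complex" where
  "circle_laplace f = (LINT t:{0..}|lebesgue. exp (- t) *\<^sub>R f (cis t))"

lemma set_integrable_exp_minus: "set_integrable lebesgue {a..} (\<lambda>t::real. exp (- t))"
  and integral_exp_minus: "(LINT t:{a..}|lebesgue. exp (- t)) = exp (- a :: real)"
proof -
  have h: "((\<lambda>t::real. exp (- t)) has_integral exp (- a)) {a..}"
    using has_integral_exp_minus_to_infinity[of 1 a] by simp
  then show s: "set_integrable lebesgue {a..} (\<lambda>t::real. exp (- t))"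
    by (intro nonnegative_absolutely_integrable_1) (auto simp: integrable_on_def)
  show "(LINT t:{a..}|lebesgue. exp (- t)) = exp (- a :: real)"
    using set_lebesgue_integral_eq_integral(2)[OF s] h by (simp add: integral_unique)
qed

text \<open>\<open>exp (- t) * B\<close> is an integrable majorant on every half line, and the
  weight has total mass 1 on \<open>{0..}\<close>.\<close>

lemma
  assumes f: "f \<in> borel_measurable circle_lebesgue" and B: "AE z in circle_lebesgue. norm (f z) \<le> B"
  shows set_integrable_laplace: "set_integrable lebesgue {a..} (\<lambda>t. exp (- t) *\<^sub>R f (cis t))"
    and circle_laplace_bound: "norm (circle_laplace f) \<le> B"
proof -
  have [measurable]: "(\<lambda>t. f (cis t)) \<in> borel_measurable lebesgue"
    using measurable_compose[OF measurable_cis_lebesgue f] .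
  have [measurable]: "(\<lambda>t::real. indicat_real {a..} t) \<in> borel_measurable lebesgue"
    "(\<lambda>t::real. exp (- t)) \<in> borel_measurable lebesgue" for a
    by (intro measurable_completion; simp)+
  have meas: "(\<lambda>t. indicat_real {a..} t *\<^sub>R exp (- t) *\<^sub>R f (cis t)) \<in> borel_measurable lebesgue" for a
    by (intro borel_measurable_scaleR) measurable
  have e: "integrable lebesgue (\<lambda>t. indicator {a..} t *\<^sub>R exp (- t))" for a :: real
    using set_integrable_exp_minus by (simp add: set_integrable_def)
  have bd: "AE t in lebesgue. norm (indicator {a..} t *\<^sub>R exp (- t) *\<^sub>R f (cis t)) \<le>
      indicator {a..} t *\<^sub>R exp (- t) * B" for a :: real
    using AE_cis_lebesgue[OF B] by eventually_elim (auto simp: indicator_def)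
  have s: "set_integrable lebesgue {a..} (\<lambda>t. exp (- t) *\<^sub>R f (cis t))" for a
    unfolding set_integrable_def
  proof (rule Bochner_Integration.integrable_bound)
    show "integrable lebesgue (\<lambda>t. indicator {a..} t *\<^sub>R exp (- t) * B)"
      using e by (rule integrable_mult_left)
    show "AE t in lebesgue. norm (indicat_real {a..} t *\<^sub>R exp (- t) *\<^sub>R f (cis t))
        \<le> norm (indicat_real {a..} t *\<^sub>R exp (- t) * B)"
      using bd[of a] by eventually_elim (rule order_trans, assumption, simp)
  qed (rule meas)
  then show "set_integrable lebesgue {a..} (\<lambda>t. exp (- t) *\<^sub>R f (cis t))" .
  have "norm (circle_laplace f) \<le> (LINT t|lebesgue. norm (indicator {0..} t *\<^sub>R exp (- t) *\<^sub>R f (cis t)))"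
    unfolding circle_laplace_def set_lebesgue_integral_def by (rule integral_norm_bound)
  also have "\<dots> \<le> (LINT t|lebesgue. indicator {0..} t *\<^sub>R exp (- t) * B)"
    using s[of 0] unfolding set_integrable_def
    by (intro integral_mono_AE bd integrable_norm integrable_mult_left e) auto
  also have "\<dots> = (LINT t:{0..}|lebesgue. exp (- t)) * B"
    unfolding set_lebesgue_integral_def by (rule integral_mult_left_zero)
  also have "\<dots> = B" by (simp add: integral_exp_minus)
  finally show "norm (circle_laplace f) \<le> B" .
qed

text \<open>Translation of the variable by \<open>s\<close>. The means of all rotated copies of
  \<open>f\<close> thus carry the same information as its weighted half-line integrals.\<close>

lemma circle_laplace_rotation:
  "circle_laplace (\<lambda>z. f (cis s * z)) = exp s *\<^sub>R (LINT t:{s..}|lebesgue. exp (- t) *\<^sub>R f (cis t))"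
proof -
  have "(LINT t:{s..}|lebesgue. exp (- t) *\<^sub>R f (cis t)) =
      (LINT t|lebesgue. indicat_real {s..} (s + 1 * t) *\<^sub>R exp (- (s + 1 * t)) *\<^sub>R f (cis (s + 1 * t)))"
    unfolding set_lebesgue_integral_def
    using lebesgue_integral_real_affine[of 1 "\<lambda>t. indicat_real {s..} t *\<^sub>R exp (- t) *\<^sub>R f (cis t)" s]
    by simp
  also have "\<dots> = (LINT t|lebesgue. exp (- s) *\<^sub>R (indicat_real {0..} t *\<^sub>R exp (- t) *\<^sub>R f (cis s * cis t)))"
    by (rule Bochner_Integration.integral_cong)
      (auto simp: indicator_def cis_mult exp_diff exp_minus divide_inverse)
  also have "\<dots> = exp (- s) *\<^sub>R circle_laplace (\<lambda>z. f (cis s * z))"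
    unfolding circle_laplace_def set_lebesgue_integral_def by (rule integral_scaleR_right)
  finally show ?thesis by (simp add: exp_minus)
qed

lemma circle_laplace_cong_AE:
  assumes "f \<in> borel_measurable circle_lebesgue" "g \<in> borel_measurable circle_lebesgue"
    and "AE z in circle_lebesgue. f z = g z"
  shows "circle_laplace f = circle_laplace g"
  unfolding circle_laplace_def set_lebesgue_integral_def
proof (rule integral_cong_AE)
  have [measurable]: "(\<lambda>t. f (cis t)) \<in> borel_measurable lebesgue" "(\<lambda>t. g (cis t)) \<in> borel_measurable lebesgue"
    using measurable_compose[OF measurable_cis_lebesgue] assms by auto
  have [measurable]: "(\<lambda>t::real. indicat_real {0..} t) \<in> borel_measurable lebesgue"
    "(\<lambda>t::real. exp (- t)) \<in> borel_measurable lebesgue"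
    by (intro measurable_completion; simp)+
  show "(\<lambda>t. indicat_real {0..} t *\<^sub>R exp (- t) *\<^sub>R f (cis t)) \<in> borel_measurable lebesgue"
    "(\<lambda>t. indicat_real {0..} t *\<^sub>R exp (- t) *\<^sub>R g (cis t)) \<in> borel_measurable lebesgue"
    by (intro borel_measurable_scaleR; measurable)+
  show "AE t in lebesgue. indicat_real {0..} t *\<^sub>R exp (- t) *\<^sub>R f (cis t) =
      indicat_real {0..} t *\<^sub>R exp (- t) *\<^sub>R g (cis t)"
    using AE_cis_lebesgue[OF assms(3)] by eventually_elim simp
qed

lemma circle_laplace_add:
  assumes "ess_bounded f" "ess_bounded g"
  shows "circle_laplace (\<lambda>z. f z + g z) = circle_laplace f + circle_laplace g"
  using assms unfolding circle_laplace_def ess_bounded_def scaleR_add_right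
  by (auto intro!: set_integral_add set_integrable_laplace)

lemma circle_laplace_scale: "circle_laplace (\<lambda>z. c * f z) = c * circle_laplace f"
proof -
  have "circle_laplace (\<lambda>z. c * f z) = (LINT t:{0..}|lebesgue. c * (exp (- t) *\<^sub>R f (cis t)))"
    unfolding circle_laplace_def by (simp only: mult_scaleR_right)
  then show ?thesis by (simp only: circle_laplace_def set_integral_mult_right)
qed

text \<open>Rotation is not norm continuous on essentially bounded functions, but this mean is
  \<open>exp s\<close> times an integral over \<open>{s..}\<close>, which near \<open>s0\<close> is
  a constant minus an indefinite integral.\<close>

lemma isCont_circle_laplace_rotation:
  assumes "ess_bounded f"
  shows "isCont (\<lambda>s. circle_laplace (\<lambda>z. f (cis s * z))) s0"
proof -
  define w where "w t = exp (- t) *\<^sub>R f (cis t)" for t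
  have w: "set_integrable lebesgue {a..} w" for a
    using assms set_integrable_laplace unfolding w_def ess_bounded_def by blast
  define a where "a = s0 - 1"
  define W where "W = (\<lambda>s. integral {a..s} w)"
  have eq: "(LINT t:{s..}|lebesgue. w t) = (LINT t:{a..}|lebesgue. w t) - W s"
    if "s \<in> {a..s0 + 1}" for s
  proof -
    have i: "set_integrable lebesgue {a..<s} w" by (rule set_integrable_subset[OF w[of a]]) auto
    have "{a..} = {a..<s} \<union> {s..}" using that by auto
    then have "(LINT t:{a..}|lebesgue. w t) = (LINT t:{a..<s}|lebesgue. w t) + (LINT t:{s..}|lebesgue. w t)"
      using set_integral_Un[OF _ i w[of s]] by (simp add: ivl_disj_int)
    moreover have "integral {a..<s} w = integral {a..s} w"
      by (rule integral_spike_set; rule negligible_subset[OF negligible_sing[of s]]) auto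
    then have "(LINT t:{a..<s}|lebesgue. w t) = integral {a..s} w"
      by (simp only: set_lebesgue_integral_eq_integral(2)[OF i])
    ultimately show ?thesis by (simp add: W_def)
  qed
  have gen: "continuous_on S V \<Longrightarrow> continuous_on S (\<lambda>s. exp s *\<^sub>R (C - V s))"
    for S :: "real set" and V :: "real \<Rightarrow> complex" and C
    by (intro continuous_intros)
  have "set_integrable lebesgue {a..s0 + 1} w"
    by (rule set_integrable_subset[OF w[of a]]) auto
  then have "w integrable_on {a..s0 + 1}"
    by (rule set_lebesgue_integral_eq_integral(1))
  then have "continuous_on {a..s0 + 1} W"
    unfolding W_def by (rule indefinite_integral_continuous_1)
  then have "continuous_on {a..s0 + 1} (\<lambda>s. exp s *\<^sub>R ((LINT t:{a..}|lebesgue. w t) - W s))"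
    by (rule gen)
  moreover have "exp s *\<^sub>R ((LINT t:{a..}|lebesgue. w t) - W s) = circle_laplace (\<lambda>z. f (cis s * z))"
    if "s \<in> {a..s0 + 1}" for s
    using eq[OF that] circle_laplace_rotation[of f s] by (simp only: w_def)
  ultimately have "continuous_on {a..s0 + 1} (\<lambda>s. circle_laplace (\<lambda>z. f (cis s * z)))"
    by (rule continuous_on_eq)
  moreover have "s0 \<in> interior {a..s0 + 1}" by (simp add: a_def)
  ultimately show ?thesis by (rule continuous_on_interior)
qed

text \<open>By \<open>circle_laplace_rotation\<close> all weighted half-line integrals vanish, so
  the integrand is zero almost everywhere on each \<open>{- real n..}\<close>. Countably many of
  these cover the line, and the weight has no zeros.\<close>

lemma AE_0_if_circle_laplace_rotation_0:
  assumes f: "ess_bounded f" and 0: "\<And>s. circle_laplace (\<lambda>z. f (cis s * z)) = 0"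
  shows "AE z in circle_lebesgue. f z = 0"
proof (rule AE_circle_if_AE_line)
  show "f \<in> borel_measurable circle_lebesgue" using f by (simp add: ess_bounded_def)
  have "AE t in lebesgue. - real n \<le> t \<longrightarrow> exp (- t) *\<^sub>R f (cis t) = 0" for n
  proof (rule AE_0_if_integrals_Ici_0)
    show "set_integrable lebesgue {- real n..} (\<lambda>t. exp (- t) *\<^sub>R f (cis t))"
      using f set_integrable_laplace unfolding ess_bounded_def by blast
    show "(LINT t:{s..}|lebesgue. exp (- t) *\<^sub>R f (cis t)) = 0" for s
      using 0[of s] by (simp add: circle_laplace_rotation)
  qed
  then have "AE t in lebesgue. \<forall>n. - real n \<le> t \<longrightarrow> exp (- t) *\<^sub>R f (cis t) = 0"
    unfolding AE_all_countable by (rule allI)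
  then show "AE t in lebesgue. f (cis t) = 0"
  proof eventually_elim
    case (elim t)
    obtain n :: nat where "- t \<le> n" using real_arch_simple by blast
    then show ?case using elim[rule_format, of n] by simp
  qed
qed

section \<open>Gelfand theory\<close>

subsection \<open>Ultrafilters\<close>

definition ultra :: "'a filter \<Rightarrow> bool" where
  "ultra U \<longleftrightarrow> U \<noteq> bot \<and> (\<forall>P. eventually P U \<or> eventually (\<lambda>x. \<not> P x) U)"

text \<open>Zorn's lemma for the proper filters below \<open>F\<close>: the infimum of a chain is
  proper, because \<open>False\<close> would already hold eventually in some member. A minimal
  proper filter decides every \<open>P\<close>, since its meet with \<open>P\<close> is either
  \<open>bot\<close> or the filter itself.\<close>

lemma ultra_exists:
  assumes "F \<noteq> bot" obtains U where "ultra U" "U \<le> F"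
proof -
  let ?A = "{G. G \<le> F \<and> G \<noteq> bot}"
  have "\<exists>U\<in>?A. \<forall>G\<in>?A. G \<le> U \<longrightarrow> G = U"
  proof (rule predicate_Zorn)
    show "partial_order_on ?A (relation_of (\<lambda>G H. H \<le> G) ?A)"
      by (rule partial_order_on_relation_ofI) auto
    fix C assume "C \<in> Chains (relation_of (\<lambda>G H. H \<le> G) ?A)"
    then have C: "C \<subseteq> ?A" "\<And>G H. G \<in> C \<Longrightarrow> H \<in> C \<Longrightarrow> G \<le> H \<or> H \<le> G"
      by (auto simp: Chains_def relation_of_def)
    show "\<exists>U\<in>?A. \<forall>G\<in>C. U \<le> G"
    proof (cases "C = {}")
      case False
      have "eventually (\<lambda>_. False) (Inf C) \<longleftrightarrow> (\<exists>G\<in>C. eventually (\<lambda>_. False) G)"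
        using False C(2) by (intro eventually_Inf_base) (auto simp: inf_absorb1 inf_absorb2; fail | metis inf.absorb1 inf.absorb2 order_refl)+
      then have "Inf C \<noteq> bot"
        using C(1) by (auto simp: trivial_limit_def)
      moreover have "Inf C \<le> F"
        using False C(1) by (auto intro: Inf_lower2)
      ultimately show ?thesis by (auto intro: Inf_lower)
    qed (use assms in auto)
  qed
  then obtain U where U: "U \<le> F" "U \<noteq> bot" "\<And>G. G \<le> U \<Longrightarrow> G \<noteq> bot \<Longrightarrow> G = U"
    by (auto intro: order_trans)
  have "eventually P U \<or> eventually (\<lambda>x. \<not> P x) U" for P
  proof (rule disjCI)
    assume "\<not> eventually (\<lambda>x. \<not> P x) U"
    then have "inf U (principal {x. P x}) \<noteq> bot"
      by (simp add: trivial_limit_def eventually_inf_principal)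
    then have "inf U (principal {x. P x}) = U"
      by (intro U(3)) auto
    moreover have "eventually P (inf U (principal {x. P x}))"
      by (simp add: eventually_inf_principal)
    ultimately show "eventually P U" by simp
  qed
  with U that[of U] show thesis by (simp add: ultra_def)
qed

text \<open>Compactness gives a cluster point \<open>l\<close> of the image filter. An ultrafilter
  that is not eventually in a neighbourhood of \<open>l\<close> is eventually outside it, which
  contradicts clustering.\<close>

lemma ultra_convergent:
  fixes f :: "'a \<Rightarrow> 'b::heine_borel"
  assumes U: "ultra U" and K: "compact K" "eventually (\<lambda>x. f x \<in> K) U"
  obtains l where "(f \<longlongrightarrow> l) U"
proof -
  have "filtermap f U \<noteq> bot" "eventually (\<lambda>y. y \<in> K) (filtermap f U)"
    using U K(2) by (auto simp: ultra_def filtermap_bot_iff eventually_filtermap)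
  then obtain l where l: "inf (nhds l) (filtermap f U) \<noteq> bot"
    using K(1) unfolding compact_filter by blast
  have "(f \<longlongrightarrow> l) U"
  proof (rule topological_tendstoI)
    fix S assume S: "open S" "l \<in> S"
    show "eventually (\<lambda>x. f x \<in> S) U"
    proof (rule ccontr)
      assume "\<not> ?thesis"
      then have "eventually (\<lambda>x. f x \<notin> S) U" using U by (auto simp: ultra_def)
      then have "eventually (\<lambda>y. y \<notin> S) (filtermap f U)" by (simp add: eventually_filtermap)
      moreover have "eventually (\<lambda>y. y \<in> S) (nhds l)" using S by (rule eventually_nhds_in_open)
      ultimately have "eventually (\<lambda>_. False) (inf (nhds l) (filtermap f U))"
        unfolding eventually_inf by blast
      with l show False by (simp add: trivial_limit_def)
    qed
  qed
  then show thesis by (rule that)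
qed

subsection \<open>Characters of the algebra of essentially bounded functions\<close>

abbreviation "cls \<equiv> abs_linf_circle"

lemma linf_rel_refl: "ess_bounded f \<Longrightarrow> linf_rel f f"
  by (simp add: linf_rel_def)

lemma cls_eqI:
  "ess_bounded f \<Longrightarrow> ess_bounded g \<Longrightarrow> (AE z in circle_lebesgue. f z = g z) \<Longrightarrow> cls f = cls g"
  by (rule Quotient3_rel_abs[OF Quotient3_linf_circle]) (simp add: linf_rel_def)

lemma cls_cases: obtains f where "ess_bounded f" "a = cls f"
proof (rule that)
  show "ess_bounded (rep_linf_circle a)"
    using Quotient3_rep_reflp[OF Quotient3_linf_circle, of a] by (simp add: linf_rel_def)
  show "a = cls (rep_linf_circle a)"
    by (rule Quotient3_abs_rep[OF Quotient3_linf_circle, symmetric])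
qed

lemma rep_cls: "ess_bounded f \<Longrightarrow> AE z in circle_lebesgue. rep_linf_circle (cls f) z = f z"
  using Quotient3_rep_abs[OF Quotient3_linf_circle linf_rel_refl] by (auto simp: linf_rel_def)

lemma cls_add: "ess_bounded f \<Longrightarrow> ess_bounded g \<Longrightarrow> cls (\<lambda>z. f z + g z) = cls f + cls g"
  and cls_mult: "ess_bounded f \<Longrightarrow> ess_bounded g \<Longrightarrow> cls (\<lambda>z. f z * g z) = cls f * cls g"
  and cls_scale: "ess_bounded f \<Longrightarrow> cls (\<lambda>z. c * f z) = linf_scale c (cls f)"
  and cls_one: "cls (\<lambda>_. 1) = 1"
  by (simp_all add: plus_linf_circle.abs_eq times_linf_circle.abs_eq linf_scale.abs_eq
      one_linf_circle_def linf_rel_refl)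

lemma ess_bounded_scale: "ess_bounded f \<Longrightarrow> ess_bounded (\<lambda>z. c * f z)"
  by (intro ess_bounded_mult ess_bounded_const)

lemma ess_bounded_diff: "ess_bounded f \<Longrightarrow> ess_bounded g \<Longrightarrow> ess_bounded (\<lambda>z. f z - g z)"
  using ess_bounded_add[OF _ ess_bounded_minus, of f g] by simp

section \<open>Spectral estimates for characters\<close>

locale linf_character =
  fixes \<phi> assumes char: "\<phi> \<in> linf_characters"
begin

lemma add: "\<phi> (a + b) = \<phi> a + \<phi> b" and mult: "\<phi> (a * b) = \<phi> a * \<phi> b"
  and scale: "\<phi> (linf_scale c a) = c * \<phi> a" and nonzero: "\<exists>a. \<phi> a \<noteq> 0"
  using char by (auto simp: linf_characters_def)

lemma one: "\<phi> 1 = 1"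
  using nonzero mult[of _ 1] by auto

lemma const: "\<phi> (cls (\<lambda>_. c)) = c"
  using cls_scale[OF ess_bounded_const, of c 1] by (simp add: scale one cls_one)

lemma cls_diff_char:
  "ess_bounded f \<Longrightarrow> ess_bounded g \<Longrightarrow> \<phi> (cls (\<lambda>z. f z - g z)) = \<phi> (cls f) - \<phi> (cls g)"
  using cls_add[of f "\<lambda>z. - 1 * g z"] cls_scale[of g "- 1"] ess_bounded_scale[of g "- 1"]
  by (simp add: add scale)

text \<open>\<open>f - c\<close> is invertible in the algebra, with inverse bounded by
  \<open>inverse \<delta>\<close>, and a character does not vanish at an invertible element.\<close>

lemma neq_if_bounded_away:
  assumes f: "ess_bounded f" and \<delta>: "\<delta> > 0" "AE z in circle_lebesgue. \<delta> \<le> norm (f z - c)"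
  shows "\<phi> (cls f) \<noteq> c"
proof -
  let ?d = "\<lambda>z. f z - c" and ?h = "\<lambda>z. inverse (f z - c)"
  have d: "ess_bounded ?d" using f by (intro ess_bounded_diff ess_bounded_const)
  have h: "ess_bounded ?h"
    unfolding ess_bounded_def
  proof (intro conjI exI)
    show "?h \<in> borel_measurable circle_lebesgue"
      using f by (auto simp: ess_bounded_def)
    show "AE z in circle_lebesgue. norm (?h z) \<le> inverse \<delta>"
      using \<delta>(2)
    proof eventually_elim
      case (elim z)
      then show ?case using \<delta>(1) by (simp add: norm_inverse le_imp_inverse_le)
    qed
  qed
  have "cls ?d * cls ?h = cls (\<lambda>z. ?d z * ?h z)"
    using d h by (rule cls_mult[symmetric])
  also have "\<dots> = cls (\<lambda>_. 1)"
  proof (rule cls_eqI)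
    show "AE z in circle_lebesgue. ?d z * ?h z = 1"
      using \<delta>(2)
    proof eventually_elim
      case (elim z)
      then have "f z - c \<noteq> 0" using \<delta>(1) by auto
      then show ?case by (rule right_inverse)
    qed
  qed (intro ess_bounded_mult d h ess_bounded_const)+
  finally have "\<phi> (cls ?d) * \<phi> (cls ?h) = 1"
    by (simp add: mult[symmetric] cls_one one)
  moreover have "\<phi> (cls ?d) = \<phi> (cls f) - c"
    using cls_diff_char[OF f ess_bounded_const] const by simp
  ultimately show ?thesis by auto
qed

text \<open>If the value of the character exceeded \<open>B\<close> in norm, \<open>f\<close> would
  stay bounded away from that value.\<close>

lemma norm_le:
  assumes f: "ess_bounded f" and B: "AE z in circle_lebesgue. norm (f z) \<le> B"
  shows "norm (\<phi> (cls f)) \<le> B"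
proof (rule ccontr)
  assume "\<not> ?thesis"
  moreover have "AE z in circle_lebesgue. norm (\<phi> (cls f)) - B \<le> norm (f z - \<phi> (cls f))"
    using B
  proof eventually_elim
    case (elim z)
    then show ?case using norm_triangle_ineq2[of "\<phi> (cls f)" "f z"] by (simp add: norm_minus_commute)
  qed
  ultimately show False using neq_if_bounded_away[OF f, of "norm (\<phi> (cls f)) - B" "\<phi> (cls f)"] by simp
qed

text \<open>A real function keeps the distance \<open>\<bar>Im c\<bar>\<close> from a number
  \<open>c\<close>, so a non-real \<open>c\<close> cannot be the value.\<close>

lemma real_if_real:
  assumes f: "ess_bounded f" and real: "\<And>z. Im (f z) = 0"
  shows "Im (\<phi> (cls f)) = 0"
proof (rule ccontr)
  assume "Im (\<phi> (cls f)) \<noteq> 0"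
  moreover have "\<bar>Im (\<phi> (cls f))\<bar> \<le> norm (f z - \<phi> (cls f))" for z
    using abs_Im_le_cmod[of "f z - \<phi> (cls f)"] real[of z] by simp
  ultimately show False
    using neq_if_bounded_away[OF f, of "\<bar>Im (\<phi> (cls f))\<bar>" "\<phi> (cls f)"] by simp
qed

end

text \<open>Limits along ultrafilters finer than the filter of conull sets are characters.\<close>

lemma character_norm_ge:
  assumes f: "ess_bounded f" and not: "\<not> (AE z in circle_lebesgue. norm (f z) < c)"
  shows "\<exists>\<phi>\<in>linf_characters. c \<le> norm (\<phi> (cls f))"
proof -
  \<comment> \<open>The set where \<open>norm (f z)\<close> is at least \<open>c\<close> is not
    null, so it meets every conull set and the filter is proper.\<close>
  let ?F = "inf (ae_filter circle_lebesgue) (principal {z. c \<le> norm (f z)})"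
  have "?F \<noteq> bot"
    using not by (simp add: trivial_limit_def eventually_inf_principal not_le)
  then obtain U where U: "ultra U" "U \<le> ?F" by (rule ultra_exists)
  have nt: "U \<noteq> bot" using U(1) by (simp add: ultra_def)
  have ae: "eventually P U" if "AE z in circle_lebesgue. P z" for P
    using order_trans[OF U(2) inf_le1] that by (simp add: le_filter_def)
  have ge: "eventually (\<lambda>z. c \<le> norm (f z)) U"
    using order_trans[OF U(2) inf_le2] by (simp add: le_principal)
  \<comment> \<open>\<open>U\<close> refines the filter of conull sets, so the limit is the same for
    every representative of the class.\<close>
  define \<phi> where "\<phi> a = Lim U (rep_linf_circle a)" for a
  have lim: "(g \<longlongrightarrow> \<phi> (cls g)) U" if g: "ess_bounded g" for g
  proof -
    obtain B where "AE z in circle_lebesgue. norm (g z) \<le> B"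
      using g by (auto simp: ess_bounded_def)
    then have "eventually (\<lambda>z. g z \<in> cball 0 B) U"
      using ae by simp
    then obtain l where l: "(g \<longlongrightarrow> l) U"
      using ultra_convergent[OF U(1) compact_cball] by blast
    then have "(rep_linf_circle (cls g) \<longlongrightarrow> l) U"
      by (rule Lim_transform_eventually) (use ae[OF rep_cls[OF g]] in \<open>simp add: eq_commute\<close>)
    then have "\<phi> (cls g) = l"
      unfolding \<phi>_def using nt by (intro tendsto_Lim)
    with l show ?thesis by simp
  qed
  have \<phi>_eq: "\<phi> (cls g) = l" if "ess_bounded g" "(g \<longlongrightarrow> l) U" for g l
    using tendsto_unique[OF nt lim[OF that(1)] that(2)] .
  have "\<phi> \<in> linf_characters"
    unfolding linf_characters_def
  proof (intro CollectI conjI allI)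
    fix a b c
    obtain g where g: "ess_bounded g" "a = cls g" by (rule cls_cases)
    obtain h where h: "ess_bounded h" "b = cls h" by (rule cls_cases)
    show "\<phi> (a + b) = \<phi> a + \<phi> b"
      unfolding g(2) h(2) cls_add[OF g(1) h(1), symmetric]
      by (intro \<phi>_eq ess_bounded_add tendsto_add lim g h)
    show "\<phi> (a * b) = \<phi> a * \<phi> b"
      unfolding g(2) h(2) cls_mult[OF g(1) h(1), symmetric]
      by (intro \<phi>_eq ess_bounded_mult tendsto_mult lim g h)
    show "\<phi> (linf_scale c a) = c * \<phi> a"
      unfolding g(2) cls_scale[OF g(1), symmetric]
      by (intro \<phi>_eq ess_bounded_scale tendsto_mult_left lim g)
    have "\<phi> (cls (\<lambda>_. 1)) = 1"
      by (intro \<phi>_eq ess_bounded_const tendsto_const)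
    then show "\<exists>a. \<phi> a \<noteq> 0" by (metis zero_neq_one)
  qed
  moreover have "c \<le> norm (\<phi> (cls f))"
    by (rule tendsto_lowerbound[OF tendsto_norm[OF lim[OF f]] ge nt])
  ultimately show ?thesis by blast
qed

text \<open>Otherwise \<open>character_norm_ge\<close> gives a character exceeding \<open>B\<close>
  by some \<open>inverse (Suc n)\<close>. Together with \<open>linf_character.norm_le\<close> this
  makes the Gelfand transform isometric.\<close>

lemma AE_norm_le_if_characters:
  assumes f: "ess_bounded f" and le: "\<And>\<phi>. \<phi> \<in> linf_characters \<Longrightarrow> norm (\<phi> (cls f)) \<le> B"
  shows "AE z in circle_lebesgue. norm (f z) \<le> B"
proof -
  have "AE z in circle_lebesgue. norm (f z) < B + inverse (Suc n)" for n
  proof (rule ccontr)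
    assume "\<not> ?thesis"
    then obtain \<phi> where "\<phi> \<in> linf_characters" "B + inverse (Suc n) \<le> norm (\<phi> (cls f))"
      using character_norm_ge[OF f] by blast
    moreover have "0 < inverse (real (Suc n))" by simp
    ultimately show False using le[of \<phi>] by linarith
  qed
  then have "AE z in circle_lebesgue. \<forall>n. norm (f z) < B + inverse (Suc n)"
    unfolding AE_all_countable by (rule allI)
  then show ?thesis
  proof eventually_elim
    case (elim z)
    have "(\<lambda>n. B + inverse (real (Suc n))) \<longlonglongrightarrow> B + 0"
      by (intro tendsto_add tendsto_const LIMSEQ_inverse_real_of_nat)
    then show ?case
      using elim by (intro LIMSEQ_le_const[of _ "B"]) (auto intro: less_imp_le)
  qed
qed

subsection \<open>The maximal ideal space\<close>

lemma continuous_map_eval: "continuous_map linf_max_ideal_space euclidean (\<lambda>\<phi>. \<phi> a)"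
  unfolding continuous_map_def topspace_linf_max_ideal_space
  unfolding linf_max_ideal_space_def by (auto intro!: topology_generated_by_Basis)

lemma continuous_map_into_linf_max_ideal_space:
  assumes "f ` topspace T \<subseteq> linf_characters"
    and "\<And>a. continuous_map T euclidean (\<lambda>x. f x a)"
  shows "continuous_map T linf_max_ideal_space f"
  unfolding linf_max_ideal_space_def
proof (rule continuous_on_generated_topo)
  fix V assume "V \<in> {{\<phi> \<in> linf_characters. \<phi> a \<in> U} |a U. open U}"
  then obtain a U where V: "V = {\<phi> \<in> linf_characters. \<phi> a \<in> U}" "open U" by blast
  have "f -` V \<inter> topspace T = {x \<in> topspace T. f x a \<in> U}" using assms(1) V by auto
  then show "openin T (f -` V \<inter> topspace T)"
    using assms(2)[of a] V(2) by (simp add: continuous_map_def)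
qed (use assms(1) in \<open>auto intro!: exI[of _ UNIV]\<close>)

lemma continuous_on_eval: "continuous_on S (\<lambda>\<phi>::'a \<Rightarrow> 'b::topological_space. \<phi> a)"
  by (rule continuous_on_subset[OF continuous_on_product_coordinates]) simp

text \<open>The argument of Banach and Alaoglu: by \<open>norm_le\<close> the characters lie in a
  product of discs, compact by Tychonoff, and they form a closed subset of it.\<close>

lemma compact_linf_characters: "compact linf_characters"
proof -
  have "\<exists>B. \<forall>\<phi>\<in>linf_characters. norm (\<phi> a) \<le> B" for a
  proof -
    obtain f where f: "ess_bounded f" "a = cls f" by (rule cls_cases)
    then obtain B where "AE z in circle_lebesgue. norm (f z) \<le> B"
      by (auto simp: ess_bounded_def)
    then show ?thesis
      using linf_character.norm_le[OF linf_character.intro f(1)] f(2) by blast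
  qed
  then obtain B where B: "\<And>a \<phi>. \<phi> \<in> linf_characters \<Longrightarrow> norm (\<phi> a) \<le> B a" by metis
  have "compactin (product_topology (\<lambda>_. euclidean) UNIV) (PiE UNIV (\<lambda>a. cball (0::complex) (B a)))"
    by (simp add: compactin_PiE)
  then have K: "compact (PiE UNIV (\<lambda>a. cball (0::complex) (B a)))"
    by (simp add: euclidean_product_topology)
  \<comment> \<open>Being nonzero is not a closed condition; for multiplicative functionals it
    amounts to \<open>\<phi> 1 = 1\<close>, which is closed.\<close>
  let ?C = "{\<phi>. (\<forall>f g. \<phi> (f + g) = \<phi> f + \<phi> g) \<and> (\<forall>c f. \<phi> (linf_scale c f) = c * \<phi> f) \<and>
      (\<forall>f g. \<phi> (f * g) = \<phi> f * \<phi> g) \<and> \<phi> 1 = 1}"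
  have "closed ?C"
    by (intro closed_Collect_conj closed_Collect_all closed_Collect_eq continuous_on_add
        continuous_on_mult continuous_on_const continuous_on_eval)
  moreover have "linf_characters = ?C"
    using linf_character.one[OF linf_character.intro] unfolding linf_characters_def
    by (auto; metis zero_neq_one)
  moreover have "linf_characters \<subseteq> PiE UNIV (\<lambda>a. cball (0::complex) (B a))"
    using B by auto
  ultimately show ?thesis
    using compact_Int_closed[OF K, of linf_characters] by (simp add: Int_absorb1)
qed

text \<open>Pointwise convergence makes all evaluations continuous, so the identity carries
  compactness over to the Gelfand topology.\<close>

lemma compact_space_linf_max_ideal_space: "compact_space linf_max_ideal_space"
proof -
  have "continuous_map (top_of_set linf_characters) linf_max_ideal_space (\<lambda>\<phi>. \<phi>)"
    by (rule continuous_map_into_linf_max_ideal_space) (auto intro: continuous_on_eval)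
  moreover have "compactin (top_of_set linf_characters) linf_characters"
    using compact_linf_characters by (simp add: compactin_subtopology)
  ultimately have "compactin linf_max_ideal_space ((\<lambda>\<phi>. \<phi>) ` linf_characters)"
    by (intro image_compactin)
  then show ?thesis by (simp add: compact_space_def topspace_linf_max_ideal_space)
qed

text \<open>A type copy of the space, since the Stone-Weierstrass theorem of the library is about
  type class topologies.\<close>

typedef linf_char = linf_characters
  using character_norm_ge[OF ess_bounded_const[of 1], of 1] AE_circle_lebesgue_False by auto

instantiation linf_char :: topological_space
begin

definition open_linf_char :: "linf_char set \<Rightarrow> bool" where
  "open_linf_char U \<longleftrightarrow> openin linf_max_ideal_space (Rep_linf_char ` U)"

instance
proof
  have "range Rep_linf_char = topspace linf_max_ideal_space"
    using type_definition.Rep_range[OF type_definition_linf_char]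
    by (simp add: topspace_linf_max_ideal_space)
  then show "open (UNIV :: linf_char set)"
    by (simp add: open_linf_char_def)
  show "open (S \<inter> T)" if "open S" "open T" for S T :: "linf_char set"
    using that by (simp add: open_linf_char_def image_Int inj_def Rep_linf_char_inject openin_Int)
  show "open (\<Union>K)" if "\<forall>S\<in>K. open S" for K :: "linf_char set set"
    using that by (auto simp: open_linf_char_def image_Union)
qed

end

lemma vimage_Rep_open:
  assumes "openin linf_max_ideal_space V" shows "open (Rep_linf_char -` V)"
proof -
  have "V \<subseteq> linf_characters"
    using openin_subset[OF assms] by (simp add: topspace_linf_max_ideal_space)
  then have "Rep_linf_char ` (Rep_linf_char -` V) = V"
    using type_definition.Rep_range[OF type_definition_linf_char] by auto
  then show ?thesis using assms by (simp add: open_linf_char_def)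
qed

lemma open_eval_vimage:
  assumes "open U" shows "open {x. Rep_linf_char x a \<in> U}"
proof -
  have "openin linf_max_ideal_space {\<phi> \<in> linf_characters. \<phi> a \<in> U}"
    using continuous_map_eval[of a] assms
    by (simp add: continuous_map_def topspace_linf_max_ideal_space)
  from vimage_Rep_open[OF this] show ?thesis
    using Rep_linf_char by (simp add: vimage_def)
qed

instance linf_char :: t2_space
proof
  fix x y :: linf_char assume "x \<noteq> y"
  then obtain a where "Rep_linf_char x a \<noteq> Rep_linf_char y a"
    by (metis Rep_linf_char_inject ext)
  from hausdorff[OF this] obtain U V where UV: "open U" "open V"
      "Rep_linf_char x a \<in> U" "Rep_linf_char y a \<in> V" "U \<inter> V = {}"
    by (elim exE conjE)
  show "\<exists>U V. open U \<and> open V \<and> x \<in> U \<and> y \<in> V \<and> U \<inter> V = {}"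
  proof (intro exI conjI)
    show "open {x. Rep_linf_char x a \<in> U}" "open {x. Rep_linf_char x a \<in> V}"
      using UV by (auto intro: open_eval_vimage)
  qed (use UV in auto)
qed

lemma continuous_on_Rep_linf_char: "continuous_on UNIV (\<lambda>x. Rep_linf_char x a)"
  unfolding continuous_on_open_vimage[OF open_UNIV]
  using open_eval_vimage by (simp add: vimage_def)

lemma compact_UNIV_linf_char: "compact (UNIV :: linf_char set)"
proof -
  have "continuous_map linf_max_ideal_space euclidean Abs_linf_char"
    unfolding continuous_map_def
  proof (intro conjI allI impI)
    fix U :: "linf_char set" assume "openin euclidean U"
    moreover have "{\<phi> \<in> linf_characters. Abs_linf_char \<phi> \<in> U} = Rep_linf_char ` U"
      using Rep_linf_char by (auto simp: Rep_linf_char_inverse image_iff) (metis Abs_linf_char_inverse)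
    ultimately show "openin linf_max_ideal_space
        {\<phi> \<in> topspace linf_max_ideal_space. Abs_linf_char \<phi> \<in> U}"
      by (simp add: open_linf_char_def topspace_linf_max_ideal_space)
  qed simp
  then have "compactin euclidean (Abs_linf_char ` linf_characters)"
    using compact_space_linf_max_ideal_space
    by (intro image_compactin[of linf_max_ideal_space])
      (simp_all add: compact_space_def topspace_linf_max_ideal_space)
  then show ?thesis
    by (simp add: type_definition.Abs_image[OF type_definition_linf_char])
qed

definition real_transforms :: "(linf_char \<Rightarrow> real) set" where
  "real_transforms = {h. \<exists>f. ess_bounded f \<and> (\<forall>z. Im (f z) = 0) \<and>
     (\<forall>x. Rep_linf_char x (cls f) = of_real (h x))}"

lemma linf_character_Rep: "linf_character (Rep_linf_char x)"
  by (rule linf_character.intro[OF Rep_linf_char])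

text \<open>Sums and products are preserved by characters. To separate points, a class with
  different values is split into real and imaginary part; one of the two separates, and their
  transforms are real by \<open>real_if_real\<close>.\<close>

lemma function_ring_on_real_transforms: "function_ring_on real_transforms UNIV"
proof
  show "compact (UNIV :: linf_char set)" by (rule compact_UNIV_linf_char)
  fix h assume "h \<in> real_transforms"
  then obtain f where f: "ess_bounded f" "\<And>z. Im (f z) = 0"
      "\<And>x. Rep_linf_char x (cls f) = of_real (h x)"
    by (auto simp: real_transforms_def)
  have "continuous_on UNIV (\<lambda>x. Re (Rep_linf_char x (cls f)))"
    by (intro continuous_on_Re continuous_on_Rep_linf_char)
  then show "continuous_on UNIV h" by (simp add: f)
  fix k assume "k \<in> real_transforms"
  then obtain g where g: "ess_bounded g" "\<And>z. Im (g z) = 0"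
      "\<And>x. Rep_linf_char x (cls g) = of_real (k x)"
    by (auto simp: real_transforms_def)
  show "(\<lambda>x. h x + k x) \<in> real_transforms"
    unfolding real_transforms_def using f g
    by (intro CollectI exI[of _ "\<lambda>z. f z + g z"])
      (auto simp: cls_add linf_character.add[OF linf_character_Rep] intro: ess_bounded_add)
  show "(\<lambda>x. h x * k x) \<in> real_transforms"
    unfolding real_transforms_def using f g
    by (intro CollectI exI[of _ "\<lambda>z. f z * g z"])
      (auto simp: cls_mult linf_character.mult[OF linf_character_Rep] intro: ess_bounded_mult)
next
  fix c
  show "(\<lambda>_. c) \<in> real_transforms"
    unfolding real_transforms_def
    by (intro CollectI exI[of _ "\<lambda>_. of_real c"])
      (auto simp: linf_character.const[OF linf_character_Rep] ess_bounded_const)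
next
  fix x y :: linf_char
  assume "x \<noteq> y"
  then obtain a where a: "Rep_linf_char x a \<noteq> Rep_linf_char y a"
    by (metis Rep_linf_char_inject ext)
  obtain f where f: "ess_bounded f" "a = cls f" by (rule cls_cases)
  let ?u = "\<lambda>z. complex_of_real (Re (f z))" and ?v = "\<lambda>z. complex_of_real (Im (f z))"
  obtain B where B: "AE z in circle_lebesgue. norm (f z) \<le> B"
    using f(1) by (auto simp: ess_bounded_def)
  have "AE z in circle_lebesgue. norm (?u z) \<le> B"
    using B by eventually_elim (use abs_Re_le_cmod order_trans in \<open>simp; blast\<close>)
  moreover have "AE z in circle_lebesgue. norm (?v z) \<le> B"
    using B by eventually_elim (use abs_Im_le_cmod order_trans in \<open>simp; blast\<close>)
  moreover have "f \<in> borel_measurable circle_lebesgue" using f by (simp add: ess_bounded_def)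
  then have "?u \<in> borel_measurable circle_lebesgue" "?v \<in> borel_measurable circle_lebesgue"
    by measurable
  ultimately have uv: "ess_bounded ?u" "ess_bounded ?v"
    by (auto simp: ess_bounded_def)
  have f_eq: "a = cls ?u + linf_scale \<i> (cls ?v)"
  proof -
    have "cls ?u + linf_scale \<i> (cls ?v) = cls (\<lambda>z. ?u z + \<i> * ?v z)"
      using uv by (simp add: cls_add cls_scale ess_bounded_scale)
    also have "(\<lambda>z. ?u z + \<i> * ?v z) = f" by (simp add: complex_eq[symmetric])
    finally show ?thesis using f by simp
  qed
  have real: "Im (Rep_linf_char t (cls w)) = 0" if "ess_bounded w" "\<And>z. Im (w z) = 0" for w t
    using linf_character.real_if_real[OF linf_character_Rep] that by blast
  have in_R: "(\<lambda>t. Re (Rep_linf_char t (cls w))) \<in> real_transforms"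
    if "ess_bounded w" "\<And>z. Im (w z) = 0" for w
    unfolding real_transforms_def using that real[OF that]
    by (intro CollectI exI[of _ w]) (auto simp: complex_eq_iff)
  have "Rep_linf_char x (cls ?u) \<noteq> Rep_linf_char y (cls ?u) \<or>
      Rep_linf_char x (cls ?v) \<noteq> Rep_linf_char y (cls ?v)"
    using a unfolding f_eq
    by (auto simp: linf_character.add[OF linf_character_Rep] linf_character.scale[OF linf_character_Rep])
  then have "Re (Rep_linf_char x (cls ?u)) \<noteq> Re (Rep_linf_char y (cls ?u)) \<or>
      Re (Rep_linf_char x (cls ?v)) \<noteq> Re (Rep_linf_char y (cls ?v))"
    using real[OF uv(1)] real[OF uv(2)] by (auto simp: complex_eq_iff)
  then show "\<exists>h\<in>real_transforms. h x \<noteq> h y"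
  proof
    assume "Re (Rep_linf_char x (cls ?u)) \<noteq> Re (Rep_linf_char y (cls ?u))"
    moreover have "(\<lambda>t. Re (Rep_linf_char t (cls ?u))) \<in> real_transforms"
      using uv(1) by (rule in_R) simp
    ultimately show ?thesis by (intro bexI[of _ "\<lambda>t. Re (Rep_linf_char t (cls ?u))"])
  next
    assume "Re (Rep_linf_char x (cls ?v)) \<noteq> Re (Rep_linf_char y (cls ?v))"
    moreover have "(\<lambda>t. Re (Rep_linf_char t (cls ?v))) \<in> real_transforms"
      using uv(2) by (rule in_R) simp
    ultimately show ?thesis by (intro bexI[of _ "\<lambda>t. Re (Rep_linf_char t (cls ?v))"])
  qed
qed

text \<open>Stone-Weierstrass approximates \<open>g\<close> uniformly by transforms of real
  functions \<open>f n\<close>. By \<open>AE_norm_le_if_characters\<close> these are uniformly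
  Cauchy almost everywhere, and their limit \<open>F\<close> has transform \<open>g\<close>.\<close>

lemma Gelfand_surj_real:
  fixes g :: "(linf_circle \<Rightarrow> complex) \<Rightarrow> real"
  assumes g: "continuous_map linf_max_ideal_space euclidean g"
  shows "\<exists>f. ess_bounded f \<and> (\<forall>z. Im (f z) = 0) \<and>
    (\<forall>\<phi>\<in>linf_characters. \<phi> (cls f) = of_real (g \<phi>))"
proof -
  define e where "e n = inverse (real (Suc n))" for n
  have e: "e \<longlonglongrightarrow> 0" "\<And>n. e n > 0"
    unfolding e_def by (rule LIMSEQ_inverse_real_of_nat, simp)
  have "open ((\<lambda>x. g (Rep_linf_char x)) -` U)" if "open U" for U
  proof -
    have "openin linf_max_ideal_space {\<phi> \<in> linf_characters. g \<phi> \<in> U}"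
      using g that by (simp add: continuous_map_def topspace_linf_max_ideal_space)
    from vimage_Rep_open[OF this] show ?thesis
      using Rep_linf_char by (simp add: vimage_def)
  qed
  then have cont: "continuous_on UNIV (\<lambda>x. g (Rep_linf_char x))"
    by (simp add: continuous_on_open_vimage)
  have "\<exists>f. ess_bounded f \<and> (\<forall>z. Im (f z) = 0) \<and>
      (\<forall>\<phi>\<in>linf_characters. norm (\<phi> (cls f) - g \<phi>) \<le> e n)" for n
  proof -
    obtain h where h: "h \<in> real_transforms" "\<And>x. \<bar>g (Rep_linf_char x) - h x\<bar> < e n"
      using function_ring_on.Stone_Weierstrass_basic[OF function_ring_on_real_transforms cont e(2)]
      by blast
    then obtain f where f: "ess_bounded f" "\<And>x. Rep_linf_char x (cls f) = of_real (h x)"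
        "\<And>z. Im (f z) = 0"
      by (auto simp: real_transforms_def)
    have "norm (\<phi> (cls f) - g \<phi>) \<le> e n" if \<phi>: "\<phi> \<in> linf_characters" for \<phi>
    proof -
      obtain x where x: "\<phi> = Rep_linf_char x" using \<phi> by (rule Rep_linf_char_cases)
      have "norm (\<phi> (cls f) - g \<phi>) = \<bar>h x - g \<phi>\<bar>"
        unfolding x f(2) by (simp flip: of_real_diff)
      then show ?thesis using h(2)[of x] unfolding x by (simp add: abs_minus_commute)
    qed
    with f(1,3) show ?thesis by blast
  qed
  then obtain f where f: "\<And>n. ess_bounded (f n)" and real: "\<And>n z. Im (f n z) = 0"
    and fg: "\<And>n \<phi>. \<phi> \<in> linf_characters \<Longrightarrow> norm (\<phi> (cls (f n)) - g \<phi>) \<le> e n"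
    by metis
  have "AE z in circle_lebesgue. norm (f n z - f m z) \<le> e n + e m" for n m
  proof (rule AE_norm_le_if_characters)
    fix \<phi> assume \<phi>: "\<phi> \<in> linf_characters"
    have "norm (\<phi> (cls (f n)) - \<phi> (cls (f m))) \<le> e n + e m"
      using norm_triangle_le_diff[OF add_mono[OF fg[OF \<phi>, of n] fg[OF \<phi>, of m]]] by simp
    then show "norm (\<phi> (cls (\<lambda>z. f n z - f m z))) \<le> e n + e m"
      by (simp add: linf_character.cls_diff_char[OF linf_character.intro[OF \<phi>]] f)
  qed (intro ess_bounded_diff f)
  then have Cauchy: "AE z in circle_lebesgue. \<forall>n m. norm (f n z - f m z) \<le> e n + e m"
    unfolding AE_all_countable by blast
  \<comment> \<open>Taking \<open>lim\<close> of the real parts makes \<open>F\<close> real at every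
    point, also where the sequence does not converge.\<close>
  define F where "F z = complex_of_real (lim (\<lambda>n. Re (f n z)))" for z
  have close: "AE z in circle_lebesgue. \<forall>n. norm (f n z - F z) \<le> e n"
    using Cauchy
  proof eventually_elim
    case (elim z)
    have "Cauchy (\<lambda>n. f n z)"
    proof (rule metric_CauchyI)
      fix r :: real assume "r > 0"
      then obtain N where N: "\<And>n. n \<ge> N \<Longrightarrow> e n < r / 2"
        using order_tendstoD(2)[OF e(1), of "r / 2"] by (auto simp: eventually_sequentially)
      have "dist (f m z) (f n z) < r" if "m \<ge> N" "n \<ge> N" for m n
        using elim[rule_format, of m n] N[OF that(1)] N[OF that(2)] by (simp add: dist_norm)
      then show "\<exists>M. \<forall>m\<ge>M. \<forall>n\<ge>M. dist (f m z) (f n z) < r" by blast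
    qed
    then obtain l where l: "(\<lambda>n. f n z) \<longlonglongrightarrow> l"
      by (auto simp: Cauchy_convergent_iff convergent_def)
    then have "(\<lambda>n. Re (f n z)) \<longlonglongrightarrow> Re l" by (rule tendsto_Re)
    then have "F z = complex_of_real (Re l)" "(\<lambda>n. complex_of_real (Re (f n z))) \<longlonglongrightarrow> complex_of_real (Re l)"
      unfolding F_def by (auto simp: limI intro: tendsto_of_real)
    moreover have "complex_of_real (Re (f n z)) = f n z" for n
      using real by (simp add: complex_eq_iff)
    ultimately have lim: "(\<lambda>n. f n z) \<longlonglongrightarrow> F z" by simp
    show ?case
    proof
      fix n
      have "(\<lambda>m. norm (f n z - f m z)) \<longlonglongrightarrow> norm (f n z - F z)"
        by (intro tendsto_intros lim)
      moreover have "(\<lambda>m. e n + e m) \<longlonglongrightarrow> e n + 0"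
        by (intro tendsto_intros e)
      ultimately show "norm (f n z - F z) \<le> e n"
        using LIMSEQ_le[of "\<lambda>m. norm (f n z - f m z)" _ "\<lambda>m. e n + e m" "e n + 0"] elim by auto
    qed
  qed
  have F: "ess_bounded F"
    unfolding ess_bounded_def
  proof
    have "f n \<in> borel_measurable circle_lebesgue" for n
      using f by (simp add: ess_bounded_def)
    then have "(\<lambda>z. lim (\<lambda>n. Re (f n z))) \<in> borel_measurable circle_lebesgue"
      by (intro borel_measurable_lim_metric) measurable
    then show "F \<in> borel_measurable circle_lebesgue"
      unfolding F_def by measurable
    obtain B where "AE z in circle_lebesgue. norm (f 0 z) \<le> B"
      using f[of 0] by (auto simp: ess_bounded_def)
    with close have "AE z in circle_lebesgue. norm (F z) \<le> B + e 0"
    proof eventually_elim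
      case (elim z)
      then show ?case
        using norm_triangle_ineq3[of "f 0 z" "F z"] spec[OF elim(1), of 0] by linarith
    qed
    then show "\<exists>B. AE z in circle_lebesgue. norm (F z) \<le> B" by blast
  qed
  have "\<phi> (cls F) = of_real (g \<phi>)" if \<phi>: "\<phi> \<in> linf_characters" for \<phi>
  proof -
    interpret linf_character \<phi> by (rule linf_character.intro[OF \<phi>])
    have "norm (of_real (g \<phi>) - \<phi> (cls F)) \<le> e n + e n" for n
    proof -
      have "AE z in circle_lebesgue. norm (f n z - F z) \<le> e n"
        using close by eventually_elim blast
      then have "norm (\<phi> (cls (f n)) - \<phi> (cls F)) \<le> e n"
        using norm_le[OF ess_bounded_diff[OF f F]] cls_diff_char[OF f F] by metis
      moreover have "norm (of_real (g \<phi>) - \<phi> (cls (f n))) \<le> e n"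
        using fg[OF \<phi>, of n] by (simp add: norm_minus_commute)
      ultimately show ?thesis by (metis norm_diff_triangle_le)
    qed
    moreover have "(\<lambda>n. e n + e n) \<longlonglongrightarrow> 0 + 0" by (intro tendsto_add e)
    ultimately have "norm (of_real (g \<phi>) - \<phi> (cls F)) \<le> 0"
      by (intro LIMSEQ_le_const[of "\<lambda>n. e n + e n"]) auto
    then show ?thesis by simp
  qed
  moreover have "Im (F z) = 0" for z by (simp add: F_def)
  ultimately show ?thesis using F by blast
qed

lemma Gelfand_surj:
  fixes g :: "(linf_circle \<Rightarrow> complex) \<Rightarrow> complex"
  assumes g: "continuous_map linf_max_ideal_space euclidean g"
  shows "\<exists>f. ess_bounded f \<and> (\<forall>\<phi>\<in>linf_characters. \<phi> (cls f) = g \<phi>)"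
proof -
  have ReIm: "continuous_map linf_max_ideal_space euclidean (\<lambda>\<phi>. Re (g \<phi>))"
    "continuous_map linf_max_ideal_space euclidean (\<lambda>\<phi>. Im (g \<phi>))"
    using continuous_map_compose[OF g, of euclidean Re] continuous_map_compose[OF g, of euclidean Im]
    by (auto simp: o_def continuous_on_Re continuous_on_Im continuous_on_id)
  obtain u where u: "ess_bounded u" "\<forall>\<phi>\<in>linf_characters. \<phi> (cls u) = of_real (Re (g \<phi>))"
    using Gelfand_surj_real[OF ReIm(1)] by auto
  obtain v where v: "ess_bounded v" "\<forall>\<phi>\<in>linf_characters. \<phi> (cls v) = of_real (Im (g \<phi>))"
    using Gelfand_surj_real[OF ReIm(2)] by auto
  show ?thesis
  proof (intro exI[of _ "\<lambda>z. u z + \<i> * v z"] conjI ballI)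
    fix \<phi> assume \<phi>: "\<phi> \<in> linf_characters"
    show "\<phi> (cls (\<lambda>z. u z + \<i> * v z)) = g \<phi>"
      using u(1) v(1) bspec[OF u(2) \<phi>] bspec[OF v(2) \<phi>] \<phi>
      by (simp add: cls_add cls_scale ess_bounded_scale linf_character.add linf_character.scale
          linf_character.intro complex_eq[symmetric])
  qed (intro ess_bounded_add ess_bounded_scale u v)
qed

section \<open>Rotations and the weighted mean on the maximal ideal space\<close>

lift_definition linf_rotate :: "real \<Rightarrow> linf_circle \<Rightarrow> linf_circle" is "\<lambda>s f z. f (cis s * z)"
  subgoal for s f g
    using AE_rotation_lebesgue[of "\<lambda>z. f z = g z" s]
    by (simp add: linf_rel_def ess_bounded_rotation)
  done

lemma linf_rotate_cls: "ess_bounded f \<Longrightarrow> linf_rotate s (cls f) = cls (\<lambda>z. f (cis s * z))"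
  by (rule linf_rotate.abs_eq[OF linf_rel_refl])

definition char_rotate :: "real \<Rightarrow> (linf_circle \<Rightarrow> complex) \<Rightarrow> linf_circle \<Rightarrow> complex" where
  "char_rotate s \<phi> a = \<phi> (linf_rotate s a)"

lemma char_rotate_cls: "ess_bounded f \<Longrightarrow> char_rotate s \<phi> (cls f) = \<phi> (cls (\<lambda>z. f (cis s * z)))"
  by (simp add: char_rotate_def linf_rotate_cls)

lemma char_rotate_in:
  assumes "\<phi> \<in> linf_characters" shows "char_rotate s \<phi> \<in> linf_characters"
proof -
  interpret linf_character \<phi> by (rule linf_character.intro[OF assms])
  show ?thesis
    unfolding linf_characters_def
  proof (intro CollectI conjI allI)
    fix a b c
    obtain f where f: "ess_bounded f" "a = cls f" by (rule cls_cases)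
    obtain g where g: "ess_bounded g" "b = cls g" by (rule cls_cases)
    note ess = f(1) g(1) ess_bounded_rotation[OF f(1)] ess_bounded_rotation[OF g(1)]
    show "char_rotate s \<phi> (a + b) = char_rotate s \<phi> a + char_rotate s \<phi> b"
      by (simp add: f g ess char_rotate_cls ess_bounded_add cls_add[symmetric])
        (simp add: ess cls_add add)
    show "char_rotate s \<phi> (a * b) = char_rotate s \<phi> a * char_rotate s \<phi> b"
      by (simp add: f g ess char_rotate_cls ess_bounded_mult cls_mult[symmetric])
        (simp add: ess cls_mult mult)
    show "char_rotate s \<phi> (linf_scale c a) = c * char_rotate s \<phi> a"
      by (simp add: f ess char_rotate_cls ess_bounded_scale cls_scale[symmetric])
        (simp add: ess cls_scale scale)
    have "char_rotate s \<phi> (cls (\<lambda>_. 1)) = 1"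
      by (simp add: char_rotate_cls ess_bounded_const const)
    then show "\<exists>a. char_rotate s \<phi> a \<noteq> 0" by (metis zero_neq_one)
  qed
qed

lemma char_rotate_add: "char_rotate s (char_rotate t \<phi>) = char_rotate (s + t) \<phi>"
proof
  fix a
  obtain f where f: "ess_bounded f" "a = cls f" by (rule cls_cases)
  show "char_rotate s (char_rotate t \<phi>) a = char_rotate (s + t) \<phi> a"
    using f ess_bounded_rotation[OF f(1)]
    by (simp add: char_rotate_cls mult.assoc[symmetric] cis_mult)
qed

lemma char_rotate_0: "char_rotate 0 \<phi> = \<phi>"
proof
  fix a
  obtain f where "ess_bounded f" "a = cls f" by (rule cls_cases)
  then show "char_rotate 0 \<phi> a = \<phi> a" by (simp add: char_rotate_cls)
qed

lemma cis_add_2pi_int: "cis (t + 2 * pi * of_int k) = cis t"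
  by (metis cis_mult cis_multiple_2pi Ints_of_int mult.right_neutral)

lemma char_rotate_periodic: "char_rotate (s + 2 * pi * of_int k) \<phi> = char_rotate s \<phi>"
proof
  fix a
  obtain f where "ess_bounded f" "a = cls f" by (rule cls_cases)
  then show "char_rotate (s + 2 * pi * of_int k) \<phi> a = char_rotate s \<phi> a"
    by (simp add: char_rotate_cls cis_add_2pi_int)
qed

lemma continuous_map_char_rotate:
  "continuous_map linf_max_ideal_space linf_max_ideal_space (char_rotate s)"
  by (rule continuous_map_into_linf_max_ideal_space)
    (auto simp: topspace_linf_max_ideal_space char_rotate_in char_rotate_def continuous_map_eval)

definition linf_mean :: "((linf_circle \<Rightarrow> complex) \<Rightarrow> complex) \<Rightarrow> complex" where
  "linf_mean g = circle_laplace
     (SOME f. ess_bounded f \<and> (\<forall>\<phi>\<in>linf_characters. \<phi> (cls f) = g \<phi>))"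

text \<open>The choice in \<open>linf_mean\<close> is harmless: all characters vanish on the
  difference of two representing functions, so these agree almost everywhere.\<close>

lemma linf_mean_eq:
  assumes f: "ess_bounded f" "\<And>\<phi>. \<phi> \<in> linf_characters \<Longrightarrow> \<phi> (cls f) = g \<phi>"
  shows "linf_mean g = circle_laplace f"
proof -
  define h where "h = (SOME f. ess_bounded f \<and> (\<forall>\<phi>\<in>linf_characters. \<phi> (cls f) = g \<phi>))"
  have h: "ess_bounded h \<and> (\<forall>\<phi>\<in>linf_characters. \<phi> (cls h) = g \<phi>)"
    unfolding h_def by (rule someI[of _ f]) (simp add: f)
  have "AE z in circle_lebesgue. norm (h z - f z) \<le> 0"
  proof (rule AE_norm_le_if_characters)
    show "norm (\<phi> (cls (\<lambda>z. h z - f z))) \<le> 0" if \<phi>: "\<phi> \<in> linf_characters" for \<phi>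
      using h f \<phi> by (simp add: linf_character.cls_diff_char[OF linf_character.intro[OF \<phi>]])
  qed (use h f in \<open>simp add: ess_bounded_diff\<close>)
  then have "AE z in circle_lebesgue. h z = f z" by simp
  then have "circle_laplace h = circle_laplace f"
    using h f by (intro circle_laplace_cong_AE) (auto simp: ess_bounded_def)
  then show ?thesis by (simp add: linf_mean_def h_def)
qed

lemma linf_mean_cong:
  "(\<And>\<phi>. \<phi> \<in> linf_characters \<Longrightarrow> f \<phi> = g \<phi>) \<Longrightarrow> linf_mean f = linf_mean g"
  unfolding linf_mean_def by (simp cong: ball_cong)

lemma linf_mean_add:
  assumes "continuous_map linf_max_ideal_space euclidean f"
    and "continuous_map linf_max_ideal_space euclidean g"
  shows "linf_mean (\<lambda>\<phi>. f \<phi> + g \<phi>) = linf_mean f + linf_mean g"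
proof -
  obtain u v where u: "ess_bounded u" "\<And>\<phi>. \<phi> \<in> linf_characters \<Longrightarrow> \<phi> (cls u) = f \<phi>"
    and v: "ess_bounded v" "\<And>\<phi>. \<phi> \<in> linf_characters \<Longrightarrow> \<phi> (cls v) = g \<phi>"
    using Gelfand_surj[OF assms(1)] Gelfand_surj[OF assms(2)] by blast
  have "linf_mean (\<lambda>\<phi>. f \<phi> + g \<phi>) = circle_laplace (\<lambda>z. u z + v z)"
    using u v by (intro linf_mean_eq ess_bounded_add)
      (simp_all add: cls_add linf_character.add linf_character.intro)
  also have "\<dots> = linf_mean f + linf_mean g"
    using u v by (simp add: circle_laplace_add linf_mean_eq)
  finally show ?thesis .
qed

lemma linf_mean_scale:
  assumes "continuous_map linf_max_ideal_space euclidean f"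
  shows "linf_mean (\<lambda>\<phi>. c * f \<phi>) = c * linf_mean f"
proof -
  obtain u where u: "ess_bounded u" "\<And>\<phi>. \<phi> \<in> linf_characters \<Longrightarrow> \<phi> (cls u) = f \<phi>"
    using Gelfand_surj[OF assms(1)] by blast
  have "linf_mean (\<lambda>\<phi>. c * f \<phi>) = circle_laplace (\<lambda>z. c * u z)"
    using u by (intro linf_mean_eq ess_bounded_scale)
      (simp_all add: cls_scale linf_character.scale linf_character.intro)
  also have "\<dots> = c * linf_mean f"
    using u by (simp add: circle_laplace_scale linf_mean_eq)
  finally show ?thesis .
qed

lemma linf_mean_bound:
  assumes "continuous_map linf_max_ideal_space euclidean f"
    and B: "\<And>\<phi>. \<phi> \<in> linf_characters \<Longrightarrow> norm (f \<phi>) \<le> B"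
  shows "norm (linf_mean f) \<le> B"
proof -
  obtain u where u: "ess_bounded u" "\<And>\<phi>. \<phi> \<in> linf_characters \<Longrightarrow> \<phi> (cls u) = f \<phi>"
    using Gelfand_surj[OF assms(1)] by blast
  have "AE z in circle_lebesgue. norm (u z) \<le> B"
    using u B by (intro AE_norm_le_if_characters) auto
  then show ?thesis
    using u by (simp add: linf_mean_eq ess_bounded_def circle_laplace_bound)
qed

lemma linf_mean_diff_bound:
  assumes f: "continuous_map linf_max_ideal_space euclidean f"
    and g: "continuous_map linf_max_ideal_space euclidean g"
    and B: "\<And>\<phi>. \<phi> \<in> linf_characters \<Longrightarrow> norm (f \<phi> - g \<phi>) \<le> B"
  shows "norm (linf_mean f - linf_mean g) \<le> B"
proof -
  have g': "continuous_map linf_max_ideal_space euclidean (\<lambda>\<phi>. - 1 * g \<phi>)"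
    using g unfolding continuous_map_euclidean_iff_tendsto by (auto intro: tendsto_minus)
  then have fg: "continuous_map linf_max_ideal_space euclidean (\<lambda>\<phi>. f \<phi> + - 1 * g \<phi>)"
    using f unfolding continuous_map_euclidean_iff_tendsto by (intro ballI tendsto_add) simp_all
  have "linf_mean f - linf_mean g = linf_mean (\<lambda>\<phi>. f \<phi> + - 1 * g \<phi>)"
    unfolding linf_mean_add[OF f g'] linf_mean_scale[OF g] by simp
  also have "norm \<dots> \<le> B"
    using B by (intro linf_mean_bound[OF fg]) simp
  finally show ?thesis .
qed

lemma circle_laplace_real:
  assumes "\<And>z. Im (f z) = 0" shows "Im (circle_laplace f) = 0"
proof -
  have "exp (- t) *\<^sub>R f (cis t) = complex_of_real (exp (- t) * Re (f (cis t)))" for t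
    using assms by (simp add: complex_eq_iff)
  then show ?thesis
    by (simp add: circle_laplace_def set_lebesgue_integral_def scaleR_conv_of_real
        flip: of_real_mult)
qed

text \<open>A real \<open>f\<close> is represented by a real-valued \<open>u\<close>, and the weight
  is real.\<close>

lemma linf_mean_real:
  assumes "continuous_map linf_max_ideal_space euclidean f"
  shows "Im (linf_mean (\<lambda>\<phi>. of_real (f \<phi>))) = 0"
proof -
  obtain u where u: "ess_bounded u" "\<And>z. Im (u z) = 0"
      "\<And>\<phi>. \<phi> \<in> linf_characters \<Longrightarrow> \<phi> (cls u) = of_real (f \<phi>)"
    using Gelfand_surj_real[OF assms] by blast
  then show ?thesis by (simp add: linf_mean_eq[of u] circle_laplace_real)
qed

lemma linf_mean_rotate:
  assumes "ess_bounded u" "\<And>\<phi>. \<phi> \<in> linf_characters \<Longrightarrow> \<phi> (cls u) = f \<phi>"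
  shows "linf_mean (\<lambda>\<phi>. f (char_rotate s \<phi>)) = circle_laplace (\<lambda>z. u (cis s * z))"
  using assms
  by (intro linf_mean_eq ess_bounded_rotation) (simp_all add: char_rotate_in flip: char_rotate_cls)

lemma isCont_linf_mean_rotate:
  assumes "continuous_map linf_max_ideal_space euclidean f"
  shows "isCont (\<lambda>s. linf_mean (\<lambda>\<phi>. f (char_rotate s \<phi>))) s0"
proof -
  obtain u where u: "ess_bounded u" "\<And>\<phi>. \<phi> \<in> linf_characters \<Longrightarrow> \<phi> (cls u) = f \<phi>"
    using Gelfand_surj[OF assms(1)] by blast
  have "linf_mean (\<lambda>\<phi>. f (char_rotate s \<phi>)) = circle_laplace (\<lambda>z. u (cis s * z))" for s
    using u by (rule linf_mean_rotate)
  then show ?thesis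
    by (simp only:) (rule isCont_circle_laplace_rotation[OF u(1)])
qed

text \<open>The rotated means are those of a function \<open>u\<close> representing
  \<open>f\<close>, so \<open>u\<close> is null and every character vanishes on its class.\<close>

lemma zero_if_linf_mean_rotate_0:
  assumes f: "continuous_map linf_max_ideal_space euclidean f"
    and 0: "\<And>s. linf_mean (\<lambda>\<phi>. f (char_rotate s \<phi>)) = 0" and \<phi>: "\<phi> \<in> linf_characters"
  shows "f \<phi> = 0"
proof -
  obtain u where u: "ess_bounded u" "\<And>\<phi>. \<phi> \<in> linf_characters \<Longrightarrow> \<phi> (cls u) = f \<phi>"
    using Gelfand_surj[OF f] by blast
  have "linf_mean (\<lambda>\<phi>. f (char_rotate s \<phi>)) = circle_laplace (\<lambda>z. u (cis s * z))" for s
    using u by (rule linf_mean_rotate)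
  then have "AE z in circle_lebesgue. u z = 0"
    using AE_0_if_circle_laplace_rotation_0[OF u(1)] 0 by simp
  then have "AE z in circle_lebesgue. norm (u z) \<le> 0" by simp
  from linf_character.norm_le[OF linf_character.intro[OF \<phi>] u(1) this]
  show ?thesis using u(2)[OF \<phi>] by simp
qed

section \<open>The flow on the product with a torus\<close>

abbreviation torus :: "'i set \<Rightarrow> ('i \<Rightarrow> complex) topology" where
  "torus I \<equiv> product_topology (\<lambda>_. top_of_set (sphere 0 1)) I"

text \<open>Real times \<open>r\<close> put the map, its inverse and its iterates into one family.
  The argument 0 of \<open>indep_real\<close> is reserved for the base circle, so the labels
  \<open>e i\<close> have to be nonzero and distinct.\<close>

definition torus_flow :: "('i \<Rightarrow> real) \<Rightarrow> 'i set \<Rightarrow> real \<Rightarrow>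
    (linf_circle \<Rightarrow> complex) \<times> ('i \<Rightarrow> complex) \<Rightarrow> (linf_circle \<Rightarrow> complex) \<times> ('i \<Rightarrow> complex)" where
  "torus_flow e I r = (\<lambda>(\<phi>, t). (char_rotate (2 * pi * r * indep_real 0) \<phi>,
     \<lambda>i\<in>I. cis (2 * pi * r * indep_real (e i)) * t i))"

lemma torus_flow_add: "torus_flow e I r (torus_flow e I r' x) = torus_flow e I (r + r') x"
  by (auto simp: torus_flow_def case_prod_unfold char_rotate_add distrib_left distrib_right
      cis_mult[symmetric] mult_ac intro!: restrict_ext)

lemma torus_flow_0: "snd x \<in> extensional I \<Longrightarrow> torus_flow e I 0 x = x"
  by (auto simp: torus_flow_def case_prod_unfold char_rotate_0 prod_eq_iff extensional_def fun_eq_iff)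

lemma continuous_map_torus_flow:
  "continuous_map (prod_topology linf_max_ideal_space (torus I))
     (prod_topology linf_max_ideal_space (torus I)) (torus_flow e I r)"
  (is "continuous_map ?X ?X _")
proof -
  have 1: "continuous_map ?X linf_max_ideal_space (\<lambda>x. char_rotate (2 * pi * r * indep_real 0) (fst x))"
    using continuous_map_compose[OF continuous_map_fst continuous_map_char_rotate] by (simp add: o_def)
  have 2: "continuous_map ?X (torus I)
      (\<lambda>x. \<lambda>i\<in>I. cis (2 * pi * r * indep_real (e i)) * snd x i)"
    unfolding continuous_map_componentwise
  proof (intro conjI ballI)
    fix i assume i: "i \<in> I"
    let ?S = "top_of_set (sphere (0::complex) 1)"
    have rot: "continuous_map ?S ?S (\<lambda>z. cis (2 * pi * r * indep_real (e i)) * z)"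
      by (auto simp: norm_mult intro!: continuous_intros)
    have proj: "continuous_map ?X ?S (\<lambda>x. snd x i)"
      using continuous_map_compose[OF continuous_map_snd continuous_map_product_projection[OF i]]
      by (simp add: o_def)
    show "continuous_map ?X ?S (\<lambda>x. (\<lambda>i\<in>I. cis (2 * pi * r * indep_real (e i)) * snd x i) i)"
      using continuous_map_compose[OF proj rot] i by (simp add: o_def)
  qed auto
  show ?thesis
    using continuous_map_pairedI[OF 1 2] by (simp add: torus_flow_def case_prod_unfold)
qed

lemma homeomorphic_maps_torus_flow:
  "homeomorphic_maps (prod_topology linf_max_ideal_space (torus I))
     (prod_topology linf_max_ideal_space (torus I)) (torus_flow e I 1) (torus_flow e I (- 1))"
  unfolding homeomorphic_maps_def
  by (auto simp: continuous_map_torus_flow torus_flow_add PiE_def intro!: torus_flow_0)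

lemma funpow_torus_flow:
  "snd x \<in> extensional I \<Longrightarrow> (torus_flow e I 1 ^^ n) x = torus_flow e I (real n) x"
  by (induction n) (simp_all add: torus_flow_0 torus_flow_add)

text \<open>The points where \<open>f\<close> deviates by at least \<open>\<epsilon>\<close> from
  the slice at \<open>t\<close> form a closed set. Projection along compact \<open>X\<close> is a
  closed map, so the complement of the image is a neighbourhood of \<open>t\<close>.\<close>

lemma tube_uniform:
  fixes f :: "'a \<times> 'b \<Rightarrow> 'c::real_normed_vector"
  assumes X: "compact_space X" and f: "continuous_map (prod_topology X Y) euclidean f"
    and t: "t \<in> topspace Y" and "\<epsilon> > 0"
  obtains V where "openin Y V" "t \<in> V" "\<And>x t'. x \<in> topspace X \<Longrightarrow> t' \<in> V \<Longrightarrow> norm (f (x, t') - f (x, t)) < \<epsilon>"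
proof -
  let ?K = "{p \<in> topspace (prod_topology X Y). norm (f p - f (fst p, t)) \<in> {\<epsilon>..}}"
  have "continuous_map (prod_topology X Y) (prod_topology X Y) (\<lambda>p. (fst p, t))"
    using t by (auto intro!: continuous_map_pairedI continuous_map_fst)
  from continuous_map_compose[OF this f]
  have "continuous_map (prod_topology X Y) euclidean (\<lambda>p. f (fst p, t))" by (simp add: o_def)
  with f have "continuous_map (prod_topology X Y) euclidean (\<lambda>p. norm (f p - f (fst p, t)))"
    unfolding continuous_map_euclidean_iff_tendsto by (auto intro!: tendsto_norm tendsto_diff)
  then have "closedin (prod_topology X Y) ?K"
    by (rule closedin_continuous_map_preimage) simp
  then have cl: "closedin Y (snd ` ?K)"
    using closed_map_snd[OF X, of Y] by (simp add: closed_map_def)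
  show thesis
  proof (rule that)
    show "openin Y (topspace Y - snd ` ?K)" using cl by (simp add: closedin_def)
    show "t \<in> topspace Y - snd ` ?K" using t \<open>\<epsilon> > 0\<close> by auto
    show "norm (f (x, t') - f (x, t)) < \<epsilon>"
      if "x \<in> topspace X" "t' \<in> topspace Y - snd ` ?K" for x t'
    proof (rule ccontr)
      assume "\<not> ?thesis"
      then have "(x, t') \<in> ?K" using that by auto
      then have "t' \<in> snd ` ?K" by force
      then show False using that by blast
    qed
  qed
qed

text \<open>The mean of the slice at \<open>t\<close> rotated by \<open>s\<close> varies
  continuously with \<open>s\<close>, and with \<open>t\<close> uniformly in \<open>s\<close>. It
  thus suffices that the orbit approaches the angle \<open>s\<close> and finitely many coordinates
  of \<open>t\<close> at a late time of the given parity.\<close>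

lemma torus_flow_dense:
  fixes f :: "(linf_circle \<Rightarrow> complex) \<times> ('i \<Rightarrow> complex) \<Rightarrow> complex"
  assumes e: "inj_on e I" "\<And>i. i \<in> I \<Longrightarrow> e i \<noteq> 0"
    and f: "continuous_map (prod_topology linf_max_ideal_space (torus I)) euclidean f"
    and t: "t \<in> topspace (torus I)" and "\<epsilon> > 0"
  shows "\<exists>n\<ge>L. (even n \<longleftrightarrow> b) \<and>
    norm (linf_mean (\<lambda>\<phi>. f (torus_flow e I (real n) (\<phi>, \<lambda>i\<in>I. 1))) -
      linf_mean (\<lambda>\<phi>. f (char_rotate s \<phi>, t))) < \<epsilon>"
proof -
  have slice: "continuous_map linf_max_ideal_space euclidean (\<lambda>\<phi>. f (\<phi>, t'))"
    if "t' \<in> topspace (torus I)" for t'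
  proof -
    have "continuous_map linf_max_ideal_space (prod_topology linf_max_ideal_space (torus I)) (\<lambda>\<phi>. (\<phi>, t'))"
      using that by (auto intro!: continuous_map_pairedI)
    from continuous_map_compose[OF this f] show ?thesis by (simp add: o_def)
  qed
  have slice_rot: "continuous_map linf_max_ideal_space euclidean (\<lambda>\<phi>. f (char_rotate r \<phi>, t'))"
    if "t' \<in> topspace (torus I)" for t' r
    using continuous_map_compose[OF continuous_map_char_rotate slice[OF that]] by (simp add: o_def)
  let ?G = "\<lambda>s t. linf_mean (\<lambda>\<phi>. f (char_rotate s \<phi>, t))"
  have "\<epsilon> / 2 > 0" using \<open>\<epsilon> > 0\<close> by simp
  obtain V where V: "openin (torus I) V" "t \<in> V"
    "\<And>\<phi> t'. \<phi> \<in> linf_characters \<Longrightarrow> t' \<in> V \<Longrightarrow> norm (f (\<phi>, t') - f (\<phi>, t)) < \<epsilon> / 2"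
    using tube_uniform[OF compact_space_linf_max_ideal_space f t \<open>\<epsilon> / 2 > 0\<close>]
    unfolding topspace_linf_max_ideal_space by blast
  \<comment> \<open>The tube bound holds at every character, also at rotated ones, so this estimate
    is uniform in \<open>r\<close>.\<close>
  have G1: "norm (?G r t' - ?G r t) \<le> \<epsilon> / 2" if "t' \<in> V" for r t'
    using that V openin_subset[OF V(1)] t
    by (intro linf_mean_diff_bound slice_rot) (auto intro!: less_imp_le char_rotate_in)
  have "\<forall>\<epsilon>>0. \<exists>\<delta>>0. \<forall>r. dist r s < \<delta> \<longrightarrow> dist (?G r t) (?G s t) < \<epsilon>"
    using isCont_linf_mean_rotate[OF slice[OF t], of s] by (simp only: continuous_at_eps_delta)
  from this[rule_format, OF \<open>\<epsilon> / 2 > 0\<close>] obtain \<delta> where \<delta>0: "\<delta> > 0"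
    and "\<forall>r. dist r s < \<delta> \<longrightarrow> dist (?G r t) (?G s t) < \<epsilon> / 2" by (elim exE conjE)
  then have \<delta>: "norm (?G r t - ?G s t) < \<epsilon> / 2" if "\<bar>r - s\<bar> < \<delta>" for r
    using that by (simp add: dist_norm)
  \<comment> \<open>A basic box around \<open>t\<close> inside \<open>V\<close> constrains only the
    finitely many coordinates collected in \<open>J\<close>.\<close>
  obtain U where U: "finite {i \<in> I. U i \<noteq> topspace (top_of_set (sphere (0::complex) 1))}"
    "\<forall>i\<in>I. openin (top_of_set (sphere 0 1)) (U i)" "t \<in> PiE I U" "PiE I U \<subseteq> V"
    using bspec[OF V(1)[unfolded openin_product_topology_alt] V(2)] by (elim exE conjE)
  define J where "J = {i \<in> I. U i \<noteq> topspace (top_of_set (sphere (0::complex) 1))}"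
  have J: "finite J" "J \<subseteq> I" using U(1) by (auto simp: J_def)
  define a where "a i = Arg (t i)" for i
  have a: "cis (a i) = t i" if "i \<in> I" for i
  proof -
    have "norm (t i) = 1" using t that by (auto simp: PiE_iff)
    moreover from this have "t i \<noteq> 0" by auto
    ultimately show ?thesis by (simp add: a_def cis_Arg sgn_div_norm)
  qed
  have "\<exists>d>0. \<forall>x. \<bar>x - a i\<bar> < d \<longrightarrow> cis x \<in> U i" if i: "i \<in> I" for i
  proof -
    obtain W where W: "open W" "U i = sphere 0 1 \<inter> W"
      using bspec[OF U(2) i] by (auto simp: openin_open)
    have "open (cis -` W)"
      using W(1) by (intro open_vimage continuous_intros)
    moreover have "a i \<in> cis -` W" using a[OF i] U(3) i W by (auto simp: PiE_iff)
    ultimately show ?thesis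
      unfolding open_dist W(2) by (auto simp: dist_real_def)
  qed
  then obtain d where d: "\<And>i. i \<in> I \<Longrightarrow> d i > 0"
      "\<And>i x. i \<in> I \<Longrightarrow> \<bar>x - a i\<bar> < d i \<Longrightarrow> cis x \<in> U i"
    by metis
  \<comment> \<open>Inserting \<open>\<delta>\<close> takes care of the base angle and keeps the set
    nonempty when \<open>J\<close> is empty.\<close>
  define \<delta>' where "\<delta>' = Min (insert \<delta> (d ` J))"
  have \<delta>': "\<delta>' > 0" "\<delta>' \<le> \<delta>" "\<And>i. i \<in> J \<Longrightarrow> \<delta>' \<le> d i"
    using J d \<delta>0 by (auto simp: \<delta>'_def Min_gr_iff)
  \<comment> \<open>Target angles in units of a full turn, indexed by the labels: 0 for the base
    circle, \<open>e i\<close> for coordinate \<open>i\<close>.\<close>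
  define \<alpha> where "\<alpha> x = (if x = 0 then s else a (the_inv_into I e x)) / (2 * pi)" for x
  have \<alpha>: "\<alpha> 0 = s / (2 * pi)" "\<And>i. i \<in> I \<Longrightarrow> \<alpha> (e i) = a i / (2 * pi)"
    using e by (auto simp: \<alpha>_def the_inv_into_f_f)
  obtain n and h :: "real \<Rightarrow> int" where n: "n \<ge> L" "even n \<longleftrightarrow> b"
    "\<And>x. x \<in> insert 0 (e ` J) \<Longrightarrow> \<bar>n * indep_real x - h x - \<alpha> x\<bar> < \<delta>' / (2 * pi)"
    using indep_real_Kronecker[of "insert 0 (e ` J)" "\<delta>' / (2 * pi)" L b \<alpha>] J(1) \<delta>'(1) by auto
  have close: "\<bar>(2 * pi * n * indep_real x + 2 * pi * of_int (- h x)) - 2 * pi * \<alpha> x\<bar> < \<delta>'"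
    if "x \<in> insert 0 (e ` J)" for x
  proof -
    have "\<bar>(2 * pi * n * indep_real x + 2 * pi * of_int (- h x)) - 2 * pi * \<alpha> x\<bar> =
        2 * pi * \<bar>n * indep_real x - h x - \<alpha> x\<bar>"
      by (subst abs_of_pos[of "2 * pi", symmetric], simp, subst abs_mult[symmetric])
        (simp add: algebra_simps)
    also have "\<dots> < 2 * pi * (\<delta>' / (2 * pi))"
      using n(3)[OF that] by (intro mult_strict_left_mono) auto
    finally show ?thesis by simp
  qed
  define \<tau> where "\<tau> = (\<lambda>i\<in>I. cis (2 * pi * n * indep_real (e i)))"
  have "\<tau> i \<in> U i" if i: "i \<in> I" for i
  proof (cases "i \<in> J")
    case True
    have "\<bar>(2 * pi * n * indep_real (e i) + 2 * pi * of_int (- h (e i))) - a i\<bar> < d i"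
      using close[of "e i"] \<delta>'(3)[OF True] True \<alpha>(2)[OF i] by simp
    then show ?thesis
      using d(2)[OF i] i unfolding \<tau>_def by (metis cis_add_2pi_int restrict_apply')
  next
    case False
    then show ?thesis using i by (simp add: J_def \<tau>_def)
  qed
  then have "\<tau> \<in> V" using U(4) by (auto simp: \<tau>_def)
  \<comment> \<open>A multiple of \<open>2 * pi\<close> is added: the rotation is unchanged, but
    \<open>?r\<close> is close to \<open>s\<close> as a real number, as \<open>\<delta>\<close>
    requires.\<close>
  let ?r = "2 * pi * n * indep_real 0 + 2 * pi * of_int (- h 0)"
  have "norm (?G ?r t - ?G s t) < \<epsilon> / 2"
    using close[of 0] \<delta>'(2) \<alpha>(1) by (intro \<delta>) simp
  moreover have "norm (?G ?r \<tau> - ?G ?r t) \<le> \<epsilon> / 2"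
    using \<open>\<tau> \<in> V\<close> by (rule G1)
  ultimately have "norm (?G ?r \<tau> - ?G s t) < \<epsilon>"
    using norm_triangle_lt[of "?G ?r \<tau> - ?G ?r t" "?G ?r t - ?G s t" \<epsilon>] by simp
  moreover have "torus_flow e I (real n) (\<phi>, \<lambda>i\<in>I. 1) = (char_rotate ?r \<phi>, \<tau>)" for \<phi>
    unfolding char_rotate_periodic by (auto simp: torus_flow_def \<tau>_def intro!: restrict_ext)
  ultimately show ?thesis using n(1,2) by (intro exI[of _ n]) auto
qed

lemma torus_flow_orbit:
  fixes f :: "(linf_circle \<Rightarrow> complex) \<times> ('i \<Rightarrow> complex) \<Rightarrow> complex"
  assumes e: "inj_on e I" "\<And>i. i \<in> I \<Longrightarrow> e i \<noteq> 0"
    and f: "continuous_map (prod_topology linf_max_ideal_space (torus I)) euclidean f"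
    and conv: "convergent (\<lambda>n. (- 1) ^ n * linf_mean (\<lambda>\<phi>. f (torus_flow e I (real n) (\<phi>, \<lambda>i\<in>I. 1))))"
    and x: "x \<in> topspace (prod_topology linf_max_ideal_space (torus I))"
  shows "f x = 0"
proof -
  obtain \<phi> t where x_eq: "x = (\<phi>, t)" and \<phi>: "\<phi> \<in> linf_characters" and t: "t \<in> topspace (torus I)"
    using x by (cases x) (auto simp: topspace_linf_max_ideal_space)
  define a where "a n = linf_mean (\<lambda>\<phi>. f (torus_flow e I (real n) (\<phi>, \<lambda>i\<in>I. 1)))" for n
  obtain l where l: "(\<lambda>n. (- 1) ^ n * a n) \<longlonglongrightarrow> l"
    using conv by (auto simp: convergent_def a_def)
  have "linf_mean (\<lambda>\<phi>. f (char_rotate s \<phi>, t)) = 0" (is "?G s = 0") for s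
  proof -
    \<comment> \<open>\<open>b\<close> selects the parity: even times put \<open>?G s\<close> near
      \<open>l\<close>, odd times near \<open>- l\<close>, so both equal \<open>?G s\<close> and it
      is 0.\<close>
    have near: "norm ((if b then l else - l) - ?G s) < \<epsilon>" if "\<epsilon> > 0" for b \<epsilon>
    proof -
      have "\<epsilon> / 2 > 0" using that by simp
      then obtain L where L: "\<And>n. n \<ge> L \<Longrightarrow> norm ((- 1) ^ n * a n - l) < \<epsilon> / 2"
        using LIMSEQ_D[OF l \<open>\<epsilon> / 2 > 0\<close>] by auto
      obtain n where n: "n \<ge> L" "even n \<longleftrightarrow> b" "norm (a n - ?G s) < \<epsilon> / 2"
        using torus_flow_dense[OF e f t \<open>\<epsilon> / 2 > 0\<close>, of L b s] by (auto simp: a_def)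
      have "norm (a n - (if b then l else - l)) < \<epsilon> / 2"
        using L[OF n(1)] n(2) by (cases b) (simp_all add: norm_minus_commute, metis add.commute norm_minus_cancel minus_add_distrib uminus_add_conv_diff diff_minus_eq_add)
      then show ?thesis
        using n(3) norm_triangle_lt[of "(if b then l else - l) - a n" "a n - ?G s" \<epsilon>]
        by (simp add: norm_minus_commute)
    qed
    have "norm ((if b then l else - l) - ?G s) \<le> 0" for b
      by (rule field_le_epsilon) (use near[of _ b] in \<open>simp add: less_imp_le\<close>)
    from this[of True] this[of False] show ?thesis by simp
  qed
  moreover have "continuous_map linf_max_ideal_space euclidean (\<lambda>\<phi>. f (\<phi>, t))"
  proof -
    have "continuous_map linf_max_ideal_space (prod_topology linf_max_ideal_space (torus I)) (\<lambda>\<phi>. (\<phi>, t))"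
      using t by (auto intro!: continuous_map_pairedI)
    from continuous_map_compose[OF this f] show ?thesis by (simp add: o_def)
  qed
  ultimately show ?thesis
    unfolding x_eq by (intro zero_if_linf_mean_rotate_0[OF _ _ \<phi>, of "\<lambda>\<phi>. f (\<phi>, t)"])
qed

lemma orbit_functional_linf_mean:
  fixes I :: "'i set" and \<nu> :: "nat \<Rightarrow> 'n"
  assumes e: "inj_on e I" "\<And>i. i \<in> I \<Longrightarrow> e i \<noteq> 0" and \<nu>: "bij_betw \<nu> UNIV N"
  shows "orbit_functional (prod_topology linf_max_ideal_space (torus I))
    (torus_flow e I 1) (torus_flow e I (- 1)) N \<nu>
    (\<lambda>f. linf_mean (\<lambda>\<phi>. f (\<phi>, \<lambda>i\<in>I. 1)))"
    (is "orbit_functional ?X _ _ _ _ _")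
proof
  let ?one = "\<lambda>i\<in>I. 1 :: complex"
  have one: "?one \<in> topspace (torus I)" by auto
  have in_X: "(\<phi>, ?one) \<in> topspace ?X" if "\<phi> \<in> linf_characters" for \<phi>
    using that one by (simp add: topspace_linf_max_ideal_space)
  have slice: "continuous_map linf_max_ideal_space euclidean (\<lambda>\<phi>. f (\<phi>, ?one))"
    if f: "continuous_map ?X euclidean f" for f :: "_ \<Rightarrow> complex"
  proof -
    have "continuous_map linf_max_ideal_space ?X (\<lambda>\<phi>. (\<phi>, ?one))"
      using one by (auto intro!: continuous_map_pairedI)
    from continuous_map_compose[OF this f] show ?thesis by (simp add: o_def)
  qed
  show "compact_space ?X"
    by (simp add: compact_space_prod_topology compact_space_linf_max_ideal_space
        compact_space_product_topology compact_space_subtopology)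
  show "homeomorphic_maps ?X ?X (torus_flow e I 1) (torus_flow e I (- 1))"
    by (rule homeomorphic_maps_torus_flow)
  show "bij_betw \<nu> UNIV N" by (rule \<nu>)
  fix f g :: "(linf_circle \<Rightarrow> complex) \<times> ('i \<Rightarrow> complex) \<Rightarrow> complex" and c B x
  show "linf_mean (\<lambda>\<phi>. f (\<phi>, ?one)) = linf_mean (\<lambda>\<phi>. g (\<phi>, ?one))"
    if "\<And>x. x \<in> topspace ?X \<Longrightarrow> f x = g x"
    by (intro linf_mean_cong that in_X)
  assume f: "continuous_map ?X euclidean f"
  show "linf_mean (\<lambda>\<phi>. f (\<phi>, ?one) + g (\<phi>, ?one)) =
      linf_mean (\<lambda>\<phi>. f (\<phi>, ?one)) + linf_mean (\<lambda>\<phi>. g (\<phi>, ?one))"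
    if "continuous_map ?X euclidean g"
    using f that by (intro linf_mean_add slice)
  show "linf_mean (\<lambda>\<phi>. c * f (\<phi>, ?one)) = c * linf_mean (\<lambda>\<phi>. f (\<phi>, ?one))"
    using f by (intro linf_mean_scale slice)
  show "norm (linf_mean (\<lambda>\<phi>. f (\<phi>, ?one))) \<le> B"
    if "\<And>x. x \<in> topspace ?X \<Longrightarrow> norm (f x) \<le> B"
    by (intro linf_mean_bound slice f that in_X)
  show "f x = 0"
    if conv: "convergent (\<lambda>n. (- 1) ^ n * linf_mean (\<lambda>\<phi>. f ((torus_flow e I 1 ^^ n) (\<phi>, ?one))))"
      and x: "x \<in> topspace ?X"
  proof (rule torus_flow_orbit[OF e f _ x])
    show "convergent (\<lambda>n. (- 1) ^ n * linf_mean (\<lambda>\<phi>. f (torus_flow e I (real n) (\<phi>, ?one))))"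
      using conv by (simp add: funpow_torus_flow)
  qed
qed

text \<open>For real scalars \<open>\<Delta>\<close> is applied to the complexified function. Its
  value is real by assumption, so \<open>Re\<close> loses nothing and convergence passes back to the
  complex functional.\<close>

lemma orbit_functional_Re:
  fixes \<Delta> :: "('a \<Rightarrow> complex) \<Rightarrow> complex"
  assumes "orbit_functional X \<phi> \<psi> N \<nu> \<Delta>"
    and real: "\<And>f. continuous_map X euclidean f \<Longrightarrow> Im (\<Delta> (\<lambda>x. of_real (f x))) = 0"
  shows "orbit_functional X \<phi> \<psi> N \<nu> (\<lambda>f. Re (\<Delta> (\<lambda>x. of_real (f x))))"
proof -
  interpret orbit_functional X \<phi> \<psi> N \<nu> \<Delta> by (rule assms(1))
  have cont: "continuous_map X euclidean (\<lambda>x. complex_of_real (f x))"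
    if "continuous_map X euclidean f" for f
    using that unfolding continuous_map_euclidean_iff_tendsto by (blast intro: tendsto_of_real)
  show ?thesis
  proof
    show "compact_space X" "homeomorphic_maps X X \<phi> \<psi>" "bij_betw \<nu> UNIV N"
      by (rule compact homeo enum)+
    fix f g :: "'a \<Rightarrow> real" and c B x
    show "Re (\<Delta> (\<lambda>x. of_real (f x))) = Re (\<Delta> (\<lambda>x. of_real (g x)))"
      if "\<And>x. x \<in> topspace X \<Longrightarrow> f x = g x"
      using that by (intro arg_cong[of _ _ Re] \<Delta>_cong) simp
    assume f: "continuous_map X euclidean f"
    show "Re (\<Delta> (\<lambda>x. of_real (f x + g x))) = Re (\<Delta> (\<lambda>x. of_real (f x))) + Re (\<Delta> (\<lambda>x. of_real (g x)))"
      if "continuous_map X euclidean g"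
      using \<Delta>_add[OF cont[OF f] cont[OF that]] by simp
    show "Re (\<Delta> (\<lambda>x. of_real (c * f x))) = c * Re (\<Delta> (\<lambda>x. of_real (f x)))"
      using \<Delta>_scale[OF cont[OF f], of "of_real c"] by simp
    show "norm (Re (\<Delta> (\<lambda>x. of_real (f x)))) \<le> B"
      if "0 \<le> B" "\<And>x. x \<in> topspace X \<Longrightarrow> norm (f x) \<le> B"
      unfolding real_norm_def
      by (rule order_trans[OF abs_Re_le_cmod \<Delta>_bound[OF cont[OF f] that(1)]]) (use that(2) in simp)
    show "f x = 0"
      if conv: "convergent (\<lambda>n. (- 1) ^ n * Re (\<Delta> (\<lambda>x. of_real (f ((\<phi> ^^ n) x)))))"
        and x: "x \<in> topspace X"
    proof -
      have pow: "continuous_map X X (\<phi> ^^ n)" for n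
      proof (induction n)
        case (Suc n)
        from continuous_map_compose[OF Suc cont_\<phi>] show ?case by (simp add: o_def)
      qed (simp add: id_def)
      have "continuous_map X euclidean (\<lambda>x. f ((\<phi> ^^ n) x))" for n
        using continuous_map_compose[OF pow f] by (simp add: o_def)
      then have "complex_of_real (Re (\<Delta> (\<lambda>x. of_real (f ((\<phi> ^^ n) x))))) = \<Delta> (\<lambda>x. of_real (f ((\<phi> ^^ n) x)))" for n
        using real by (simp add: complex_eq_iff)
      moreover have "convergent (\<lambda>n. complex_of_real ((- 1) ^ n * Re (\<Delta> (\<lambda>x. of_real (f ((\<phi> ^^ n) x))))))"
        using conv by (auto simp: convergent_def simp del: of_real_mult intro: tendsto_of_real)
      ultimately have "convergent (\<lambda>n. (- 1) ^ n * \<Delta> (\<lambda>x. of_real (f ((\<phi> ^^ n) x))))"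
        by simp
      from \<Delta>_orbit[OF cont[OF f] this x] show ?thesis by simp
    qed
  qed
qed

theorem theorem3p2:
  fixes I :: "'i set" and N :: "'n set"
  assumes "I \<noteq> {}" and "I \<lesssim> (UNIV :: real set)"
    and "countable N" and "infinite N"
  defines "X \<equiv> disjoint_sum_topology
      (prod_topology linf_max_ideal_space
        (product_topology (\<lambda>_. top_of_set (sphere (0::complex) 1)) I))
      (Alexandroff_compactification (discrete_topology N))"
  shows "admits_isometric_shift TYPE(real) X \<and> admits_isometric_shift TYPE(complex) X"
proof -
  let ?X = "prod_topology linf_max_ideal_space (torus I)"
  have \<nu>: "bij_betw (from_nat_into N) UNIV N"
    using assms(3,4) by (rule bij_betw_from_nat_into)
  obtain e0 :: "'i \<Rightarrow> real" where e0: "inj_on e0 I"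
    using assms(2) by (auto simp: lepoll_def)
  \<comment> \<open>\<open>exp\<close> keeps the labels distinct and makes them nonzero.\<close>
  define e where "e i = exp (e0 i)" for i
  have e: "inj_on e I" "\<And>i. i \<in> I \<Longrightarrow> e i \<noteq> 0"
    using e0 by (auto simp: e_def inj_on_def)
  note c = orbit_functional_linf_mean[OF e \<nu>]
  have slice: "continuous_map linf_max_ideal_space euclidean (\<lambda>\<phi>. f (\<phi>, \<lambda>i\<in>I. 1))"
    if f: "continuous_map ?X euclidean f" for f :: "_ \<Rightarrow> real"
  proof -
    have "continuous_map linf_max_ideal_space ?X (\<lambda>\<phi>. (\<phi>, \<lambda>i\<in>I. 1))"
      by (auto intro!: continuous_map_pairedI)
    from continuous_map_compose[OF this f] show ?thesis by (simp add: o_def)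
  qed
  \<comment> \<open>Complex scalars use \<open>c\<close> directly; real scalars use its real part on
    real functions.\<close>
  have "orbit_functional ?X (torus_flow e I 1) (torus_flow e I (- 1)) N (from_nat_into N)
      (\<lambda>f. Re (linf_mean (\<lambda>\<phi>. of_real (f (\<phi>, \<lambda>i\<in>I. 1)))))"
    using orbit_functional_Re[OF c] linf_mean_real[OF slice] by blast
  then show ?thesis
    unfolding X_def
    using orbit_functional.admits_isometric_shift[OF c] orbit_functional.admits_isometric_shift by blast
qed

end
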